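(* Let $H_S$ be a finite group with $M_S$ conjugacy classes, let $X$ be an infinite set, let $W_S=H_S\wr_X\mathrm{Sym}(X)$, and let $S^{(W_S)}$ be a sufficiently large (that is, PCwr) generating set of $W_S$. Write $\gamma_{W_S}(n)=\gamma_{W_S,S^{(W_S)}}(n)$. Then $$C_{W_S,S^{(W_S)}}(q)=\sum_{n=0}^\infty\gamma_{W_S}(n)q^n=\prod_{n=1}^\infty\left(1-q^n\right)^{-M_S},$$ and for every $n\ge 2$ the numbers $\gamma_{W_S}(n)$ satisfy the recurrence relation $$\gamma_{W_S}(n)=\widehat{F}_n\big(\gamma_{W_S}(1),\dots,\gamma_{W_S}(n-1)\big)+\frac{M_S}{n}\,\sigma_1(n),$$ where $\sigma_1(n)=\sum_{d\mid n}d$ and, for $n\ge2$, $$\widehat{F}_n(x_1,\dots,x_{n-1}):=\sum_{\substack{m_1,\dots,m_{n-1}\geq0 \\ m_1+2m_2+\cdots+(n-1)m_{n-1}=n}}(-1)^{m_1+\cdots+m_{n-1}}\frac{(m_1+\cdots+m_{n-1}-1)!}{m_1!\cdots m_{n-1}!}\,x_1^{m_1}\cdots x_{n-1}^{m_{n-1}}.$$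
   Context: $\mathrm{Sym}(X)$ is the group of permutations of the infinite set $X$ with finite support. For a group $H$, $H^{(X)}$ is the group of functions $X\to H$ with finite support (value $1$ outside a finite set), and $H\wr_X\mathrm{Sym}(X):=H^{(X)}\rtimes\mathrm{Sym}(X)$, where $f\in\mathrm{Sym}(X)$ acts by $\psi\mapsto f(\psi)=\psi\circ f^{-1}$ and $(\varphi,f)(\psi,g)=(\varphi f(\psi),fg)$. For a group $G$ generated by a set $S$, the word length $\ell_{G,S}(g)$ is the smallest $n\ge0$ such that $g=s_1\cdots s_n$ with $s_i\in S\cup S^{-1}$; the conjugacy length $\kappa_{G,S}(g)$ is the smallest word length of an element of the conjugacy class of $g$; $\gamma_{G,S}(n)$ is the number of conjugacy classes of $G$ whose conjugacy length is $n$. If all $\gamma_{G,S}(n)$ are finite, the conjugacy growth series is $C_{G,S}(q)=\sum_{n\ge0}\gamma_{G,S}(n)q^n$. Sufficiently large (PCwr) generating sets of $W=H\wr_X\mathrm{Sym}(X)$: for $a\in H\setminus\{1\}$ and $u\in X$ let $\varphi_u^a\in H^{(X)}\subset W$ be the function with value $a$ at $u$ and $1$ elsewhere. Let $T_H=\{\varphi_u^a: a\in H\setminus\{1\},u\in X\}$ and let $T_X\subset\mathrm{Sym}(X)\subset W$ be the set of all transpositions $(x\ y)$ of distinct elements of $X$. Let $S=S_H\sqcup S_X$ with $S_H\subset T_H$, $S_X\subset T_X$. The transposition graph $\Gamma(S_X)$ has vertex set $X$ and an edge $\{x,y\}$ for each $(x\ y)\in S_X$. The set $S$ is PCwr ("partition-complete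 for wreath products") if (i) $\Gamma(S_X)$ is connected, and (ii) for all $L\ge0$ and all partitions $\lambda=(\lambda_1,\dots,\lambda_k)$ of $L$, $\Gamma(S_X)$ contains a forest of $k$ trees $T_1,\dots,T_k$, where $T_i$ has $\lambda_i$ vertices, including one vertex $x^{(i)}$ such that $\varphi_{x^{(i)}}^a\in S_H$ for all $a\in H\setminus\{1\}$. *)

theory Defs
  imports
    "HOL-Algebra.Generated_Groups"
    "HOL-Combinatorics.Permutations"
    "HOL-Computational_Algebra.Formal_Power_Series"
    "HOL-Analysis.Infinite_Products"
begin

definition conj_class :: "('a, 'b) monoid_scheme \<Rightarrow> 'a \<Rightarrow> 'a set" where
  "conj_class G g = {h \<otimes>\<^bsub>G\<^esub> g \<otimes>\<^bsub>G\<^esub> inv\<^bsub>G\<^esub> h |h. h \<in> carrier G}"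

definition conj_classes :: "('a, 'b) monoid_scheme \<Rightarrow> 'a set set" where
  "conj_classes G = conj_class G ` carrier G"

definition word_prod :: "('a, 'b) monoid_scheme \<Rightarrow> 'a list \<Rightarrow> 'a" where
  "word_prod G w = foldr (\<lambda>s g. s \<otimes>\<^bsub>G\<^esub> g) w \<one>\<^bsub>G\<^esub>"

definition word_length :: "('a, 'b) monoid_scheme \<Rightarrow> 'a set \<Rightarrow> 'a \<Rightarrow> nat" where
  "word_length G S g = (LEAST n. \<exists>w. length w = n \<and> set w \<subseteq> S \<union> (\<lambda>s. inv\<^bsub>G\<^esub> s) ` S \<and> word_prod G w = g)"

definition conj_length :: "('a, 'b) monoid_scheme \<Rightarrow> 'a set \<Rightarrow> 'a \<Rightarrow> nat" where
  "conj_length G S g = (LEAST n. \<exists>h \<in> conj_class G g. word_length G S h = n)"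

definition classes_of_length :: "('a, 'b) monoid_scheme \<Rightarrow> 'a set \<Rightarrow> nat \<Rightarrow> 'a set set" where
  "classes_of_length G S n = conj_class G ` {g \<in> carrier G. conj_length G S g = n}"

text \<open>Meaningful only when \<^term>\<open>classes_of_length G S n\<close> is finite, since \<^const>\<open>card\<close> is 0 on infinite sets.\<close>

definition conj_growth :: "('a, 'b) monoid_scheme \<Rightarrow> 'a set \<Rightarrow> nat \<Rightarrow> nat" where
  "conj_growth G S n = card (classes_of_length G S n)"

definition conj_growth_series :: "('a, 'b) monoid_scheme \<Rightarrow> 'a set \<Rightarrow> rat fps" where
  "conj_growth_series G S = Abs_fps (\<lambda>n. of_nat (conj_growth G S n))"

text \<open>
  Following the convention of \<^const>\<open>permutes\<close>, permutations of \<^term>\<open>X\<close> are the identity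
  outside \<^term>\<open>X\<close>; likewise, functions \<open>X \<rightarrow> H\<close> take the value \<open>\<one>\<close> outside \<^term>\<open>X\<close>.
\<close>

definition finitary_perms :: "'x set \<Rightarrow> ('x \<Rightarrow> 'x) set" where
  "finitary_perms X = {f. f permutes X \<and> finite {x. f x \<noteq> x}}"

definition finsupp_funs :: "('a, 'b) monoid_scheme \<Rightarrow> 'x set \<Rightarrow> ('x \<Rightarrow> 'a) set" where
  "finsupp_funs H X = {\<phi>. (\<forall>x. \<phi> x \<in> carrier H) \<and> {x. \<phi> x \<noteq> \<one>\<^bsub>H\<^esub>} \<subseteq> X \<and> finite {x. \<phi> x \<noteq> \<one>\<^bsub>H\<^esub>}}"

definition wreath :: "('a, 'b) monoid_scheme \<Rightarrow> 'x set \<Rightarrow> (('x \<Rightarrow> 'a) \<times> ('x \<Rightarrow> 'x)) monoid" where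
  "wreath H X =
    \<lparr> carrier = finsupp_funs H X \<times> finitary_perms X,
      monoid.mult = (\<lambda>(\<phi>, f) (\<psi>, g). (\<lambda>x. \<phi> x \<otimes>\<^bsub>H\<^esub> \<psi> (inv_into UNIV f x), f \<circ> g)),
      one = (\<lambda>_. \<one>\<^bsub>H\<^esub>, id) \<rparr>"

definition point_elem :: "('a, 'b) monoid_scheme \<Rightarrow> 'x \<Rightarrow> 'a \<Rightarrow> ('x \<Rightarrow> 'a) \<times> ('x \<Rightarrow> 'x)" where
  "point_elem H u a = ((\<lambda>_. \<one>\<^bsub>H\<^esub>)(u := a), id)"

definition transp_elem :: "('a, 'b) monoid_scheme \<Rightarrow> 'x \<Rightarrow> 'x \<Rightarrow> ('x \<Rightarrow> 'a) \<times> ('x \<Rightarrow> 'x)" where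
  "transp_elem H x y = (\<lambda>_. \<one>\<^bsub>H\<^esub>, Transposition.transpose x y)"

definition point_elems :: "('a, 'b) monoid_scheme \<Rightarrow> 'x set \<Rightarrow> (('x \<Rightarrow> 'a) \<times> ('x \<Rightarrow> 'x)) set" where
  "point_elems H X = {point_elem H u a |u a. u \<in> X \<and> a \<in> carrier H - {\<one>\<^bsub>H\<^esub>}}"

definition transp_elems :: "('a, 'b) monoid_scheme \<Rightarrow> 'x set \<Rightarrow> (('x \<Rightarrow> 'a) \<times> ('x \<Rightarrow> 'x)) set" where
  "transp_elems H X = {transp_elem H x y |x y. x \<in> X \<and> y \<in> X \<and> x \<noteq> y}"

text \<open>
  A simple undirected graph is given by a vertex set and a set of two-element sets of vertices.
\<close>

definition graph_connected :: "'x set \<Rightarrow> 'x set set \<Rightarrow> bool" where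
  "graph_connected V E \<longleftrightarrow> (\<forall>x\<in>V. \<forall>y\<in>V. (x, y) \<in> {(u, v). {u, v} \<in> E}\<^sup>*)"

definition is_cycle :: "'x set set \<Rightarrow> 'x list \<Rightarrow> bool" where
  "is_cycle E xs \<longleftrightarrow> length xs \<ge> 3 \<and> distinct xs \<and>
     (\<forall>i. Suc i < length xs \<longrightarrow> {xs ! i, xs ! Suc i} \<in> E) \<and> {last xs, hd xs} \<in> E"

definition is_tree :: "'x set \<Rightarrow> 'x set set \<Rightarrow> bool" where
  "is_tree V E \<longleftrightarrow> V \<noteq> {} \<and> E \<subseteq> {{x, y} |x y. x \<in> V \<and> y \<in> V \<and> x \<noteq> y} \<and>
     graph_connected V E \<and> (\<nexists>xs. is_cycle E xs)"

definition transp_graph_edges ::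
    "('a, 'b) monoid_scheme \<Rightarrow> 'x set \<Rightarrow> (('x \<Rightarrow> 'a) \<times> ('x \<Rightarrow> 'x)) set \<Rightarrow> 'x set set" where
  "transp_graph_edges H X S\<^sub>X = {{x, y} |x y. x \<in> X \<and> y \<in> X \<and> x \<noteq> y \<and> transp_elem H x y \<in> S\<^sub>X}"

definition is_partition :: "nat list \<Rightarrow> nat \<Rightarrow> bool" where
  "is_partition lam L \<longleftrightarrow> sorted_wrt (\<ge>) lam \<and> (\<forall>l\<in>set lam. l \<ge> 1) \<and> sum_list lam = L"

definition PCwr :: "('a, 'b) monoid_scheme \<Rightarrow> 'x set \<Rightarrow>
    (('x \<Rightarrow> 'a) \<times> ('x \<Rightarrow> 'x)) set \<Rightarrow> (('x \<Rightarrow> 'a) \<times> ('x \<Rightarrow> 'x)) set \<Rightarrow> bool" where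
  "PCwr H X S\<^sub>H S\<^sub>X \<longleftrightarrow>
     S\<^sub>H \<subseteq> point_elems H X \<and> S\<^sub>X \<subseteq> transp_elems H X \<and>
     graph_connected X (transp_graph_edges H X S\<^sub>X) \<and>
     (\<forall>L lam. is_partition lam L \<longrightarrow>
        (\<exists>V E x.
           disjoint_family_on V {..<length lam} \<and>
           (\<forall>i<length lam.
              is_tree (V i) (E i) \<and> V i \<subseteq> X \<and> E i \<subseteq> transp_graph_edges H X S\<^sub>X \<and>
              card (V i) = lam ! i \<and> x i \<in> V i \<and>
              (\<forall>a \<in> carrier H - {\<one>\<^bsub>H\<^esub>}. point_elem H (x i) a \<in> S\<^sub>H))))"

definition Fhat :: "nat \<Rightarrow> (nat \<Rightarrow> rat) \<Rightarrow> rat" where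
  "Fhat n x =
     (\<Sum>m \<in> {m \<in> {1..n-1} \<rightarrow>\<^sub>E UNIV. (\<Sum>i = 1..n-1. i * m i) = n}.
        (-1) ^ (\<Sum>i = 1..n-1. m i)
        * (fact ((\<Sum>i = 1..n-1. m i) - 1) / (\<Prod>i = 1..n-1. fact (m i)))
        * (\<Prod>i = 1..n-1. x i ^ m i))"

definition divisor_sum :: "nat \<Rightarrow> nat" where
  "divisor_sum n = (\<Sum>d | d dvd n. d)"

end

theory Submission
  imports Defs "HOL-Combinatorics.Cycles" "HOL-Library.Multiset"
begin

text \<open>
  An element \<open>(\<phi>, f)\<close> of the wreath product is determined up to conjugacy by the multiset of pairs
  \<open>(k, c)\<close>, one for each cycle of \<open>f\<close>, with \<open>k\<close> the length of the cycle and \<open>c\<close> the conjugacy class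
  of the product of \<open>\<phi>\<close> along it; trivial fixed points are not counted. The conjugacy length is the
  sum of the weights \<open>k - [c = 1]\<close>. It is a lower bound because a word with few letters leaves
  many connected components in the graph spanned by its letters, and it is attained because a
  tree of transpositions multiplies to a cycle and PCwr sets contain all required forests. For
  every \<open>n \<ge> 1\<close> there are exactly \<open>M\<close> pairs of weight \<open>n\<close>, whence the product formula. The
  recurrence compares coefficients of the logarithm of both sides: the multinomial expansion of
  \<open>ln (1 + \<Sum> \<gamma> (i) q\<^sup>i)\<close> has \<open>n\<close>-th coefficient \<open>\<gamma> (n) - Fhat n \<gamma>\<close>, and the logarithmic derivative
  of the product yields the divisor sum.
\<close>

text \<open>A conjugating element identifies two actions on \<open>X \<times> H\<close> over a
  bijection of \<open>X\<close>. Along a cycle such an identification is determined by its value at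
  one point, and the only obstruction, met when the cycle closes up, is conjugacy of the two cycle
  products; hence the invariant. As \<open>X\<close> is infinite, trivial fixed points cannot be
  counted, so two elements are compared on a finite set containing both supports, where equal cycle
  types force equally many trivial points. The lower bound joins two estimates through the number of
  components of the graph of a word: points plus marked components are at most letters plus
  components, and each unmarked component contains a whole cycle with trivial product, which saves
  one unit of weight. There are infinitely many pairs \<open>(k, c)\<close>, but those of weight
  above \<open>n\<close> do not affect coefficient \<open>n\<close>, so finite products suffice and
  the infinite product is their coefficientwise limit. In the logarithm, \<open>\<gamma> (n)\<close>
  enters degree \<open>n\<close> only through the linear term. This is why \<open>Fhat n\<close>
  involves only smaller indices; its factorial \<open>(r - 1)!\<close> is the \<open>r!\<close> of
  the multinomial coefficient divided by the \<open>r\<close> of the logarithm series.\<close>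

unbundle no vec_syntax
unbundle fps_syntax

section \<open>The logarithm of a power series\<close>

lemma finite_PiE_sum_eq:
  assumes "finite I"
  shows "finite {m \<in> I \<rightarrow>\<^sub>E UNIV. sum m I = (r :: nat)}"
proof (rule finite_subset)
  show "{m \<in> I \<rightarrow>\<^sub>E UNIV. sum m I = r} \<subseteq> I \<rightarrow>\<^sub>E {..r}"
    using assms by (auto simp: PiE_iff extensional_def intro!: member_le_sum)
  show "finite (I \<rightarrow>\<^sub>E {..r})"
    using assms by (intro finite_PiE) auto
qed

lemma prod_fun_upd_notin: "j \<notin> I \<Longrightarrow> (\<Prod>i\<in>I. h i ((m(j := k)) i)) = (\<Prod>i\<in>I. h i (m i))"
  by (intro prod.cong) auto

text \<open>Induction on \<open>I\<close>: the binomial theorem splits off one summand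
  \<open>b j\<close>. Exponent vectors are extensional functions, so that each is counted
  once.\<close>

lemma multinomial_fps:
  fixes b :: "'i \<Rightarrow> 'k::field_char_0 fps"
  assumes "finite I"
  shows "sum b I ^ r = (\<Sum>m | m \<in> I \<rightarrow>\<^sub>E UNIV \<and> sum m I = r.
    fps_const (fact r / (\<Prod>i\<in>I. fact (m i))) * (\<Prod>i\<in>I. b i ^ m i))"
  using assms
proof (induction I arbitrary: r rule: finite_induct)
  case empty
  have "{m. m = (\<lambda>x. undefined) \<and> r = 0} = (if r = 0 then {\<lambda>x::'i. undefined::nat} else {})"
    by auto
  then show ?case by (auto simp: power_0_left)
next
  case (insert j I)
  let ?A = "\<lambda>r. {m. m \<in> I \<rightarrow>\<^sub>E UNIV \<and> sum m I = (r :: nat)}"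
  let ?B = "{m. m \<in> insert j I \<rightarrow>\<^sub>E UNIV \<and> sum m (insert j I) = r}"
  let ?f = "\<lambda>r m. fps_const (fact r / (\<Prod>i\<in>I. fact (m i))) * (\<Prod>i\<in>I. b i ^ m i)"
  let ?g = "\<lambda>m. fps_const (fact r / (\<Prod>i\<in>insert j I. fact (m i))) * (\<Prod>i\<in>insert j I. b i ^ m i)"
  have fin: "finite (?A s)" for s
    using finite_PiE_sum_eq[OF insert.hyps(1), of s] by simp
  have upds: "sum (m(j := k)) I = sum m I" for m :: "'i \<Rightarrow> nat" and k
    using insert.hyps by (intro sum.cong) auto
  have "sum b (insert j I) ^ r = (\<Sum>k\<le>r. of_nat (r choose k) * b j ^ k * sum b I ^ (r - k))"
    using insert.hyps by (simp add: binomial_ring)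
  also have "\<dots> = (\<Sum>k\<le>r. \<Sum>m\<in>?A (r - k). of_nat (r choose k) * b j ^ k * ?f (r - k) m)"
    by (simp only: insert.IH sum_distrib_left)
  also have "\<dots> = (\<Sum>(k, m)\<in>(SIGMA k:{..r}. ?A (r - k)). of_nat (r choose k) * b j ^ k * ?f (r - k) m)"
    using fin by (intro sum.Sigma) auto
  \<comment> \<open>A vector on \<open>insert j I\<close> is its value \<open>k\<close> at
    \<open>j\<close> together with a vector on \<open>I\<close>; resetting \<open>j\<close> to
    \<open>undefined\<close> makes the latter extensional again.\<close>
  also have "\<dots> = (\<Sum>m\<in>?B. ?g m)"
  proof (rule sum.reindex_bij_witness[where j = "\<lambda>(k, m). m(j := k)" and
        i = "\<lambda>m. (m j, m(j := undefined))"], goal_cases)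
    case (1 a)
    then obtain k m where "a = (k, m)" "m \<in> I \<rightarrow>\<^sub>E UNIV" by auto
    moreover from this have "m j = undefined" using insert.hyps by (auto simp: PiE_iff extensional_def)
    ultimately show ?case by (auto simp: fun_eq_iff)
  next
    case (2 a)
    then show ?case using insert.hyps
      by (auto simp: upds PiE_def extensional_def simp del: fun_upd_apply) auto
  next
    case (3 m)
    then show ?case using insert.hyps by (auto simp: fun_eq_iff)
  next
    case (4 m)
    then show ?case using insert.hyps
      by (auto simp: upds PiE_def extensional_def simp del: fun_upd_apply) auto
  next
    case (5 a)
    obtain k m where a: "a = (k, m)" by force
    with 5 have k: "k \<le> r" by auto
    have c: "of_nat (r choose k) = (fps_const (fact r / (fact k * fact (r - k))) :: 'k fps)"
      using k by (simp add: fps_of_nat[symmetric] binomial_fact)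
    have "?g (m(j := k)) = fps_const (fact r / (fact k * (\<Prod>i\<in>I. fact (m i)))) * (b j ^ k * (\<Prod>i\<in>I. b i ^ m i))"
      using insert.hyps prod_fun_upd_notin[of j I "\<lambda>i. fact :: nat \<Rightarrow> 'k" m k]
        prod_fun_upd_notin[of j I "\<lambda>i e. b i ^ e" m k] by simp
    also have "fact r / (fact k * (\<Prod>i\<in>I. fact (m i))) =
      (fact r / (fact k * fact (r - k))) * (fact (r - k) / (\<Prod>i\<in>I. fact (m i)) :: 'k)"
      by (simp add: field_simps)
    finally show ?case
      unfolding a prod.case c by (simp only: mult_ac fps_const_mult[symmetric])
  qed
  finally show ?case .
qed

text \<open>With summands \<open>x i * X ^ i\<close>, each term of the multinomial expansion is a
  monomial of degree \<open>\<Sum>i. i * m i\<close>, so coefficient \<open>n\<close> selects the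
  vectors of that weight.\<close>

lemma weighted_sum_power_nth:
  fixes x :: "nat \<Rightarrow> 'k::field_char_0"
  assumes "finite I"
  shows "((\<Sum>i\<in>I. fps_const (x i) * fps_X ^ i) ^ r) $ n =
    (\<Sum>m | m \<in> I \<rightarrow>\<^sub>E UNIV \<and> sum m I = r \<and> (\<Sum>i\<in>I. i * m i) = n.
      fact r / (\<Prod>i\<in>I. fact (m i)) * (\<Prod>i\<in>I. x i ^ m i))"
proof -
  let ?A = "{m. m \<in> I \<rightarrow>\<^sub>E UNIV \<and> sum m I = (r :: nat)}"
  have fin: "finite ?A"
    using finite_PiE_sum_eq[OF assms, of r] by simp
  have p: "(\<Prod>i\<in>I. (fps_const (x i) * fps_X ^ i) ^ m i) =
      fps_const (\<Prod>i\<in>I. x i ^ m i) * fps_X ^ (\<Sum>i\<in>I. i * m i)" for m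
  proof -
    have "(\<Prod>i\<in>I. fps_const (x i ^ m i)) = fps_const (\<Prod>i\<in>I. x i ^ m i)"
      by (induction I rule: infinite_finite_induct) auto
    then show ?thesis
      by (simp add: power_mult_distrib prod.distrib power_sum fps_const_power power_mult)
  qed
  have "((\<Sum>i\<in>I. fps_const (x i) * fps_X ^ i) ^ r) $ n =
    (\<Sum>m\<in>?A. if (\<Sum>i\<in>I. i * m i) = n then fact r / (\<Prod>i\<in>I. fact (m i)) * (\<Prod>i\<in>I. x i ^ m i) else 0)"
    unfolding multinomial_fps[OF assms] fps_sum_nth p mult.assoc[symmetric] fps_const_mult
    by (intro sum.cong) (auto simp del: fps_const_mult)
  also have "\<dots> = (\<Sum>m | m \<in> I \<rightarrow>\<^sub>E UNIV \<and> sum m I = r \<and> (\<Sum>i\<in>I. i * m i) = n.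
      fact r / (\<Prod>i\<in>I. fact (m i)) * (\<Prod>i\<in>I. x i ^ m i))"
    using fin by (subst sum.inter_filter[symmetric]) (auto intro!: sum.cong)
  finally show ?thesis .
qed

text \<open>Group the exponent vectors by their total \<open>r\<close>. The logarithm series has
  coefficient \<open>(-1) ^ (r - 1) / r\<close>, and \<open>r! / r = (r - 1)!\<close> turns the
  multinomial coefficient into the one of \<open>Fhat\<close>, up to the global sign.\<close>

lemma Fhat_eq_ln:
  assumes "n \<ge> 1"
  shows "Fhat n x = - ((fps_ln 1 oo (\<Sum>i=1..n-1. fps_const (x i) * fps_X ^ i)) $ n)"
proof -
  let ?I = "{1..n-1}"
  let ?A = "{m \<in> ?I \<rightarrow>\<^sub>E UNIV. (\<Sum>i\<in>?I. i * m i) = n}"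
  let ?t = "\<lambda>m. (-1) ^ (\<Sum>i\<in>?I. m i) * (fact ((\<Sum>i\<in>?I. m i) - 1) / (\<Prod>i\<in>?I. fact (m i)))
        * (\<Prod>i\<in>?I. x i ^ m i)"
  have sub: "?A \<subseteq> ?I \<rightarrow>\<^sub>E {..n}"
  proof
    fix m assume m: "m \<in> ?A"
    have "m i \<le> n" if "i \<in> ?I" for i
    proof -
      have "m i \<le> i * m i" using that by auto
      also have "\<dots> \<le> (\<Sum>i\<in>?I. i * m i)" using that by (intro member_le_sum) auto
      finally show ?thesis using m by simp
    qed
    then show "m \<in> ?I \<rightarrow>\<^sub>E {..n}" using m by (auto simp: PiE_iff)
  qed
  have fin: "finite ?A"
    by (rule finite_subset[OF sub]) (auto intro: finite_PiE)
  \<comment> \<open>Because \<open>n \<ge> 1\<close>, the zero vector is excluded, so the natural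
    subtraction \<open>r - 1\<close> in \<open>Fhat\<close> is never truncated.\<close>
  have ran: "sum m ?I \<in> {1..n}" if "m \<in> ?A" for m
  proof -
    have "sum m ?I \<le> (\<Sum>i\<in>?I. i * m i)" by (intro sum_mono) auto
    moreover have "1 \<le> sum m ?I"
    proof (rule ccontr)
      assume "\<not> 1 \<le> sum m ?I"
      then have "sum m ?I = 0" by linarith
      then have "m i = 0" if "i \<in> ?I" for i using that by simp
      then have "(\<Sum>i\<in>?I. i * m i) = 0" by simp
      then show False using that assms by simp
    qed
    ultimately show ?thesis using that by (simp only: atLeastAtMost_iff mem_Collect_eq)
  qed
  have "Fhat n x = (\<Sum>m\<in>?A. ?t m)" unfolding Fhat_def ..
  also have "\<dots> = (\<Sum>r\<in>{1..n}. \<Sum>m | m \<in> ?A \<and> sum m ?I = r. ?t m)"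
    using ran fin by (intro sum.group[symmetric]) auto
  also have "\<dots> = (\<Sum>r\<in>{1..n}. - (fps_ln 1 $ r * ((\<Sum>i\<in>?I. fps_const (x i) * fps_X ^ i) ^ r) $ n))"
  proof (rule sum.cong[OF refl])
    fix r assume r: "r \<in> {1..n}"
    have "(\<Sum>m | m \<in> ?A \<and> sum m ?I = r. ?t m) =
      (\<Sum>m | m \<in> ?I \<rightarrow>\<^sub>E UNIV \<and> sum m ?I = r \<and> (\<Sum>i\<in>?I. i * m i) = n.
        - fps_ln 1 $ r * (fact r / (\<Prod>i\<in>?I. fact (m i)) * (\<Prod>i\<in>?I. x i ^ m i)))"
    proof (rule sum.cong, goal_cases)
      case 1 show ?case by auto
    next
      case (2 m)
      then have s: "sum m ?I = r" by auto
      obtain r' where r': "r = Suc r'" using r by (cases r) auto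
      have f: "fact r = (of_nat r * fact (r - 1) :: rat)"
        unfolding r' by simp
      have "of_nat r \<noteq> (0::rat)" using r by simp
      moreover have "(-1::rat) ^ r = - ((-1) ^ (r - 1))" unfolding r' by simp
      ultimately show ?case
        unfolding s f using r by (simp add: fps_ln_nth field_simps)
    qed
    also have "\<dots> = - (fps_ln 1 $ r * ((\<Sum>i\<in>?I. fps_const (x i) * fps_X ^ i) ^ r) $ n)"
      by (subst weighted_sum_power_nth) (auto simp: sum_distrib_left sum_negf)
    finally show "(\<Sum>m | m \<in> ?A \<and> sum m ?I = r. ?t m) = \<dots>" .
  qed
  also have "\<dots> = - ((fps_ln 1 oo (\<Sum>i\<in>?I. fps_const (x i) * fps_X ^ i)) $ n)"
    unfolding fps_compose_nth
    by (simp add: sum_negf sum.atLeast_Suc_atMost[of 0 n])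
  finally show ?thesis .
qed

text \<open>\<open>A ^ r - B ^ r\<close> is \<open>A - B\<close>, which vanishes below degree
  \<open>n\<close>, times a sum that has no constant term once \<open>r \<ge> 2\<close>. So only the
  first power sees the coefficient in degree \<open>n\<close>.\<close>

lemma fps_nth_pow_cong_below:
  fixes A B :: "'k::comm_ring_1 fps"
  assumes eq: "\<And>i. i < n \<Longrightarrow> A $ i = B $ i" and "A $ 0 = 0" "B $ 0 = 0" and r: "r \<ge> 2" "n \<ge> 1"
  shows "(A ^ r) $ n = (B ^ r) $ n"
proof -
  let ?S = "\<Sum>i<r. B ^ (r - Suc i) * A ^ i"
  have "?S $ 0 = 0"
    unfolding fps_sum_nth
  proof (rule sum.neutral, safe)
    fix i assume "i < r"
    then have "r - Suc i \<noteq> 0 \<or> i \<noteq> 0" using r by auto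
    then show "(B ^ (r - Suc i) * A ^ i) $ 0 = 0" using assms by (auto simp: fps_power_zeroth power_0_left)
  qed
  moreover have "A ^ r - B ^ r = (A - B) * ?S" by (rule power_diff_sumr2)
  moreover have "((A - B) * S) $ n = 0" if "S $ 0 = 0" for S
    unfolding fps_mult_nth
  proof (rule sum.neutral, safe)
    fix i assume "i \<in> {0..n}"
    then show "(A - B) $ i * S $ (n - i) = 0"
      using eq[of i] that by (cases "i = n") auto
  qed
  ultimately have "(A ^ r - B ^ r) $ n = 0" by metis
  then show ?thesis by simp
qed

text \<open>Coefficient \<open>n\<close> of the logarithm of \<open>P\<close> is computed in two
  ways: by expanding in powers of \<open>P - 1\<close>, where cutting off at degree
  \<open>n - 1\<close> loses exactly \<open>P $ n\<close>, and by integrating \<open>P' / P\<close>,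
  which gives the division by \<open>n\<close>.\<close>

lemma fps_ln_recurrence:
  fixes P :: "rat fps"
  assumes P0: "P $ 0 = 1" and n: "n \<ge> 2"
  shows "P $ n = Fhat n (\<lambda>i. P $ i) + (fps_deriv P * inverse P) $ (n - 1) / of_nat n"
proof -
  let ?B = "P - 1"
  define T where "T = (\<Sum>i=1..n-1. fps_const (P $ i) * fps_X ^ i)"
  have Tn: "T $ i = (if i \<in> {1..n-1} then P $ i else 0)" for i
    unfolding T_def by (auto simp: fps_sum_nth if_distrib sum.delta cong: if_cong)
  have "(?B ^ r) $ n = (T ^ r) $ n + (if r = 1 then P $ n else 0)" for r
  proof -
    consider "r = 0" | "r = 1" | "r \<ge> 2" by linarith
    then show ?thesis
    proof cases
      case 3
      have "(?B ^ r) $ n = (T ^ r) $ n"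
        using n 3 P0 by (intro fps_nth_pow_cong_below) (auto simp: Tn)
      then show ?thesis using 3 by simp
    qed (use n in \<open>auto simp: Tn\<close>)
  qed
  then have "(fps_ln 1 oo ?B) $ n = (fps_ln 1 oo T) $ n + (\<Sum>r\<in>{0..n}. fps_ln 1 $ r * (if r = 1 then P $ n else 0))"
    unfolding fps_compose_nth by (simp add: ring_distribs sum.distrib)
  also have "(\<Sum>r\<in>{0..n}. fps_ln 1 $ r * (if r = 1 then P $ n else 0)) = P $ n"
  proof -
    have "(\<Sum>r\<in>{0..n}. fps_ln 1 $ r * (if r = 1 then P $ n else 0)) =
      (\<Sum>r\<in>{0..n}. if r = 1 then fps_ln 1 $ 1 * P $ n else 0)"
      by (intro sum.cong) auto
    then show ?thesis using n by (simp add: fps_ln_nth)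
  qed
  finally have *: "P $ n = Fhat n (\<lambda>i. P $ i) + (fps_ln 1 oo ?B) $ n"
    using Fhat_eq_ln[of n "\<lambda>i. P $ i", folded T_def] n by simp
  have B0: "?B $ 0 = 0" using P0 by simp
  have "fps_deriv (fps_ln 1 oo ?B) = (inverse (1 + fps_X) oo ?B) * fps_deriv P"
    using fps_compose_deriv[OF B0, of "fps_ln 1"] by (simp add: fps_ln_deriv)
  also have "inverse (1 + fps_X) oo ?B = inverse P"
    using B0 by (subst fps_inverse_compose) (auto simp: fps_compose_add_distrib)
  finally have "fps_deriv (fps_ln 1 oo ?B) $ (n - 1) = (fps_deriv P * inverse P) $ (n - 1)"
    by (simp add: mult.commute)
  then have "(fps_ln 1 oo ?B) $ n = (fps_deriv P * inverse P) $ (n - 1) / of_nat n"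
    using n by (simp add: field_simps)
  with * show ?thesis by simp
qed

section \<open>The logarithmic derivative of the Euler product\<close>

lemma deriv_geometric_power:
  fixes M d :: nat
  assumes "d \<ge> 1"
  defines "Q \<equiv> inverse ((1 - fps_X ^ d) ^ M) :: rat fps"
  shows "fps_deriv Q * inverse Q = of_nat (M * d) * fps_X ^ (d - 1) * inverse (1 - fps_X ^ d)"
    and "Q $ 0 = 1"
proof -
  let ?D = "1 - fps_X ^ d :: rat fps"
  have D0: "?D $ 0 = 1" using assms by simp
  have Q: "Q = inverse ?D ^ M" unfolding Q_def by (simp add: fps_inverse_power)
  then show Q0: "Q $ 0 = 1" using D0 using assms(1) by (simp add: fps_power_zeroth power_0_left)
  have D: "?D * inverse ?D = 1" using inverse_mult_eq_1[of ?D] D0 by (simp add: mult.commute)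
  have dI: "fps_deriv (inverse ?D) = of_nat d * fps_X ^ (d - 1) * (inverse ?D)\<^sup>2"
  proof -
    have "fps_deriv (inverse ?D) = - fps_deriv ?D * (inverse ?D)\<^sup>2"
      by (rule fps_inverse_deriv) (metis D0 one_neq_zero)
    also have "fps_deriv ?D = - (of_nat d * fps_X ^ (d - 1))"
      by (simp add: fps_deriv_power fps_of_nat)
    finally show ?thesis by (simp only: minus_minus)
  qed
  have iQ: "inverse Q = ?D ^ M"
    unfolding Q_def using D0 by (intro fps_inverse_idempotent) (metis D0 fps_power_zeroth one_neq_zero power_one)
  have "fps_deriv Q * inverse Q = of_nat M * fps_deriv (inverse ?D) * (inverse ?D ^ (M - 1) * ?D ^ M)"
    unfolding iQ unfolding Q fps_deriv_power by (simp add: fps_of_nat mult_ac)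
  also have "\<dots> = of_nat M * fps_deriv (inverse ?D) * ?D"
  \<comment> \<open>The truncated exponent \<open>M - 1\<close> is harmless: for
    \<open>M = 0\<close> both sides carry the factor \<open>of_nat M = 0\<close>.\<close>
  proof (cases M)
    case (Suc k)
    have "inverse ?D ^ k * ?D ^ Suc k = (?D * inverse ?D) ^ k * ?D"
      by (simp add: power_mult_distrib mult_ac)
    then show ?thesis using Suc D by simp
  qed simp
  also have "\<dots> = of_nat (M * d) * fps_X ^ (d - 1) * inverse ?D * (?D * inverse ?D)"
    unfolding dI power2_eq_square of_nat_mult by (simp only: mult_ac)
  finally show "fps_deriv Q * inverse Q = of_nat (M * d) * fps_X ^ (d - 1) * inverse ?D"
    using D by simp
qed

lemma inverse_one_minus_X_power_nth:
  assumes "d \<ge> 1"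
  shows "inverse (1 - fps_X ^ d :: 'k::field fps) $ n = (if d dvd n then 1 else 0)"
proof -
  let ?G = "Abs_fps (\<lambda>n. if d dvd n then 1 else 0) :: 'k fps"
  have "?G * (1 - fps_X ^ d) = 1"
  proof (rule fps_ext)
    fix n
    show "(?G * (1 - fps_X ^ d)) $ n = 1 $ n"
    proof (cases "d \<le> n")
      case True
      then have "d dvd n - d \<longleftrightarrow> d dvd n" using dvd_diffD[of d n d] dvd_diff_nat[of d n d] by auto
      then show ?thesis
        using True assms by (auto simp: ring_distribs fps_X_power_mult_right_nth)
    next
      case False
      then have "d dvd n \<longleftrightarrow> n = 0" by (auto dest: dvd_imp_le)
      then show ?thesis
        using False by (auto simp: ring_distribs fps_X_power_mult_right_nth)
    qed
  qed
  then have "inverse (1 - fps_X ^ d) = ?G"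
    by (intro fps_inverse_unique) (simp only: mult.commute)
  then show ?thesis by simp
qed

lemma prod_nth_0: "prod f I $ 0 = (\<Prod>i\<in>I. f i $ 0)"
  by (induction I rule: infinite_finite_induct) auto

lemma log_deriv_prod:
  fixes f :: "'i \<Rightarrow> 'k::field fps"
  assumes "finite I" "\<And>i. i \<in> I \<Longrightarrow> f i $ 0 \<noteq> 0"
  shows "fps_deriv (prod f I) * inverse (prod f I) = (\<Sum>i\<in>I. fps_deriv (f i) * inverse (f i))"
  using assms
proof (induction I rule: finite_induct)
  case (insert j I)
  have "prod f I $ 0 \<noteq> 0" using insert.prems insert.hyps by (auto simp: prod_nth_0)
  then have "prod f I * inverse (prod f I) = 1" "f j * inverse (f j) = 1"
    using inverse_mult_eq_1 insert.prems by (metis mult.commute insertI1)+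
  note inv = this
  have "fps_deriv (f j * prod f I) * inverse (f j * prod f I) =
    fps_deriv (f j) * inverse (f j) * (prod f I * inverse (prod f I)) +
    fps_deriv (prod f I) * inverse (prod f I) * (f j * inverse (f j))"
    by (simp add: fps_inverse_mult ring_distribs mult_ac)
  then show ?case
    using insert by (simp add: inv)
qed simp

text \<open>The factor with \<open>d = Suc i\<close> has logarithmic derivative
  \<open>M * d * X ^ (d - 1) / (1 - X ^ d)\<close>, which contributes \<open>M * d\<close> in degree
  \<open>n - 1\<close> exactly when \<open>d\<close> divides \<open>n\<close>. The product up to
  \<open>i = n\<close> contains all divisors; the factor \<open>d = n + 1\<close> contributes
  nothing.\<close>

lemma log_deriv_partition_prod:
  fixes n M :: nat
  assumes "n \<ge> 1"
  defines "P \<equiv> (\<Prod>i\<le>n. inverse ((1 - fps_X ^ Suc i) ^ M)) :: rat fps"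
  shows "(fps_deriv P * inverse P) $ (n - 1) = of_nat M * of_nat (divisor_sum n)"
proof -
  have c: "(of_nat (M * Suc i) * fps_X ^ i * inverse (1 - fps_X ^ Suc i)) $ (n - 1) =
     (if Suc i dvd n then of_nat M * of_nat (Suc i) else 0 :: rat)" for i
  proof -
    have "(fps_X ^ i * inverse (1 - fps_X ^ Suc i)) $ (n - 1) = (if Suc i dvd n then 1 else 0 :: rat)"
    proof (cases "Suc i \<le> n")
      case True
      then have "n - 1 - i = n - Suc i" by simp
      moreover have "Suc i dvd n - Suc i \<longleftrightarrow> Suc i dvd n"
        using True by (auto simp: dvd_minus_self simp del: diff_Suc_Suc)
      ultimately show ?thesis
        using True by (simp only: fps_X_power_mult_nth inverse_one_minus_X_power_nth le_add1 plus_1_eq_Suc) auto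
    next
      case False
      then show ?thesis using assms by (auto simp: fps_X_power_mult_nth dest: dvd_imp_le)
    qed
    then show ?thesis
      unfolding mult.assoc fps_of_nat[symmetric] fps_mult_left_const_nth by (simp add: ring_distribs)
  qed
  have "(fps_deriv P * inverse P) $ (n - 1) =
     (\<Sum>i\<le>n. (of_nat (M * Suc i) * fps_X ^ i * inverse (1 - fps_X ^ Suc i)) $ (n - 1))" 
  proof -
    let ?Q = "\<lambda>i. inverse ((1 - fps_X ^ Suc i) ^ M) :: rat fps"
    have Q: "fps_deriv (?Q i) * inverse (?Q i) = of_nat (M * Suc i) * fps_X ^ i * inverse (1 - fps_X ^ Suc i)"
      "?Q i $ 0 = 1" for i
      using deriv_geometric_power[of "Suc i" M] by (simp_all only: le_add1 plus_1_eq_Suc diff_Suc_1)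
    have "fps_deriv P * inverse P = (\<Sum>i\<le>n. fps_deriv (?Q i) * inverse (?Q i))"
      unfolding P_def by (rule log_deriv_prod) (simp_all only: Q, simp_all)
    then show ?thesis by (simp only: Q fps_sum_nth)
  qed
  also have "\<dots> = (\<Sum>i\<le>n. if Suc i dvd n then of_nat M * of_nat (Suc i) else 0)"
    unfolding c ..
  also have "\<dots> = (\<Sum>d | d dvd n. of_nat M * of_nat d)"
  proof -
    have "(\<Sum>i\<le>n. if Suc i dvd n then of_nat M * of_nat (Suc i) else 0 :: rat) =
      (\<Sum>i | i \<le> n \<and> Suc i dvd n. of_nat M * of_nat (Suc i))"
      by (subst sum.inter_filter[symmetric]) (auto intro: sum.cong)
    also have "\<dots> = (\<Sum>d | d dvd n. of_nat M * of_nat d)"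
    proof (rule sum.reindex_bij_witness[where j = Suc and i = "\<lambda>d. d - 1"])
      fix d assume d: "d \<in> {d. d dvd n}"
      then have "d \<noteq> 0" using assms by (intro notI) auto
      moreover have "d \<le> n" using d assms by (auto intro: dvd_imp_le)
      ultimately show "d - 1 \<in> {i. i \<le> n \<and> Suc i dvd n}" "Suc (d - 1) = d" using d by auto
    qed auto
    finally show ?thesis .
  qed
  finally show "(fps_deriv P * inverse P) $ (n - 1) = of_nat M * of_nat (divisor_sum n)"
    by (simp add: divisor_sum_def sum_distrib_left)
qed

section \<open>Multisets of given weight\<close>

definition weighted_multisets :: "'i set \<Rightarrow> ('i \<Rightarrow> nat) \<Rightarrow> nat \<Rightarrow> 'i multiset set" where
  "weighted_multisets J w n = {A. set_mset A \<subseteq> J \<and> (\<Sum>i\<in>#A. w i) = n}"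

lemma finite_weighted_multisets:
  assumes "finite J" "\<And>i. i \<in> J \<Longrightarrow> w i \<ge> 1"
  shows "finite (weighted_multisets J w n)"
proof (rule finite_subset)
  have "size A \<le> (\<Sum>i\<in>#A. w i)" if "set_mset A \<subseteq> J" for A
    using that
  proof (induction A)
    case (add x A)
    then show ?case using assms(2)[of x] by simp
  qed simp
  then show "weighted_multisets J w n \<subseteq> (\<Union>k\<le>n. {A. set_mset A \<subseteq> J \<and> size A = k})"
    unfolding weighted_multisets_def by blast
  show "finite (\<Union>k\<le>n. {A. set_mset A \<subseteq> J \<and> size A = k})"
    using assms(1) finite_multisets_of_size unfolding multisets_of_size_def by blast
qed

text \<open>Either \<open>j\<close> does not occur, or one copy of it can be removed. The rest may
  contain \<open>j\<close> again, so the recursion stays in \<open>insert j J\<close>.\<close>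

lemma weighted_multisets_insert:
  assumes "j \<notin> J"
  shows "weighted_multisets (insert j J) w n = weighted_multisets J w n \<union>
    (if w j \<le> n then add_mset j ` weighted_multisets (insert j J) w (n - w j) else {})"
proof -
  have "A \<in> add_mset j ` weighted_multisets (insert j J) w (n - w j)" "w j \<le> n"
    if "A \<in> weighted_multisets (insert j J) w n" "A \<notin> weighted_multisets J w n" for A
  proof -
    have "j \<in># A" using that by (auto simp: weighted_multisets_def)
    then obtain B where "A = add_mset j B" by (metis multi_member_split)
    then show "A \<in> add_mset j ` weighted_multisets (insert j J) w (n - w j)" "w j \<le> n"
      using that(1) by (auto simp: weighted_multisets_def)
  qed
  then have "weighted_multisets (insert j J) w n \<subseteq> weighted_multisets J w n \<union>
    (if w j \<le> n then add_mset j ` weighted_multisets (insert j J) w (n - w j) else {})"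
    by auto
  moreover have "weighted_multisets J w n \<subseteq> weighted_multisets (insert j J) w n"
    by (auto simp: weighted_multisets_def)
  moreover have "add_mset j ` weighted_multisets (insert j J) w (n - w j) \<subseteq> weighted_multisets (insert j J) w n"
    if "w j \<le> n"
    using that by (auto simp: weighted_multisets_def)
  ultimately show ?thesis by (intro equalityI) (auto split: if_splits)
qed

text \<open>In terms of generating functions the recursion reads
  \<open>G (insert j J) * (1 - X ^ w j) = G J\<close>. Positivity of \<open>w j\<close> makes the
  second factor invertible.\<close>

lemma weighted_multisets_gf:
  assumes "finite J" "\<And>i. i \<in> J \<Longrightarrow> w i \<ge> 1"
  shows "Abs_fps (\<lambda>n. of_nat (card (weighted_multisets J w n))) =
    (\<Prod>i\<in>J. inverse (1 - fps_X ^ w i) :: 'k::field_char_0 fps)"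
  using assms
proof (induction J rule: finite_induct)
  case empty
  have "weighted_multisets {} w n = (if n = 0 then {{#}} else {})" for n
    by (auto simp: weighted_multisets_def)
  then show ?case by (intro fps_ext) simp
next
  case (insert j J)
  let ?G = "\<lambda>J. Abs_fps (\<lambda>n. of_nat (card (weighted_multisets J w n))) :: 'k fps"
  have fin: "finite (weighted_multisets J w n)" "finite (weighted_multisets (insert j J) w n)" for n
    using insert by (auto intro!: finite_weighted_multisets)
  have "?G (insert j J) * (1 - fps_X ^ w j) = ?G J"
  proof (rule fps_ext)
    fix n
    have inj: "inj (add_mset j)" by (auto simp: inj_def)
    have dis: "weighted_multisets J w n \<inter> add_mset j ` K = {}" for K
      using insert.hyps by (auto simp: weighted_multisets_def)
    have "card (weighted_multisets (insert j J) w n) = card (weighted_multisets J w n) +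
      (if w j \<le> n then card (weighted_multisets (insert j J) w (n - w j)) else 0)"
    proof (cases "w j \<le> n")
      case True
      then show ?thesis
        unfolding weighted_multisets_insert[OF insert.hyps(2), of w n] 
        by (simp only: if_True card_Un_disjoint[OF fin(1) finite_imageI[OF fin(2)] dis]
            card_image[OF inj_on_subset[OF inj subset_UNIV]])
    next
      case False
      then show ?thesis
        unfolding weighted_multisets_insert[OF insert.hyps(2), of w n] by simp
    qed
    then show "(?G (insert j J) * (1 - fps_X ^ w j)) $ n = ?G J $ n"
      by (simp add: right_diff_distrib fps_X_power_mult_right_nth)
  qed
  moreover have "(1 - fps_X ^ w j) * inverse (1 - fps_X ^ w j) = (1 :: 'k fps)"
    using insert.prems[of j] by (intro inverse_mult_eq_1') (simp add: power_0_left)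
  ultimately have "?G (insert j J) = ?G J * inverse (1 - fps_X ^ w j)"
    using mult.assoc[of "?G (insert j J)" "1 - fps_X ^ w j" "inverse (1 - fps_X ^ w j)"]
    by (simp only: mult_1_right)
  also have "?G J = (\<Prod>i\<in>J. inverse (1 - fps_X ^ w i))"
    using insert by simp
  finally show ?case using insert.hyps by (simp add: mult.commute)
qed

section \<open>Cycle products\<close>

text \<open>
  The element \<open>(\<phi>, f)\<close> of the wreath product acts on \<open>X \<times> H\<close> by \<open>(x, h) \<mapsto> (f x, \<phi> (f x) h)\<close>; its
  \<open>n\<close>-th power sends \<open>(x, 1)\<close> to \<open>(f\<^sup>n x, cocycle H \<phi> f n x)\<close>.
\<close>

primrec cocycle :: "('a, 'b) monoid_scheme \<Rightarrow> ('x \<Rightarrow> 'a) \<Rightarrow> ('x \<Rightarrow> 'x) \<Rightarrow> nat \<Rightarrow> 'x \<Rightarrow> 'a" where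
  "cocycle H \<phi> f 0 x = \<one>\<^bsub>H\<^esub>"
| "cocycle H \<phi> f (Suc n) x = \<phi> ((f ^^ Suc n) x) \<otimes>\<^bsub>H\<^esub> cocycle H \<phi> f n x"

text \<open>\<open>least_power f x\<close> is the length of the cycle through \<open>x\<close>.
  Starting the product at another point of the cycle conjugates it, so only its conjugacy class
  depends on the cycle alone.\<close>

definition cycle_data :: "('a, 'b) monoid_scheme \<Rightarrow> ('x \<Rightarrow> 'a) \<Rightarrow> ('x \<Rightarrow> 'x) \<Rightarrow> 'x \<Rightarrow> nat \<times> 'a set" where
  "cycle_data H \<phi> f x = (least_power f x, conj_class H (cocycle H \<phi> f (least_power f x) x))"

text \<open>
  Cycle types are recorded pointwise, so that a cycle of length \<open>k\<close> contributes \<open>k\<close> times. This makes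
  conjugation invariance immediate; \<open>expand\<close> turns a multiset of cycles into this form.
\<close>

definition expand :: "(nat \<times> 'c) multiset \<Rightarrow> (nat \<times> 'c) multiset" where
  "expand A = (\<Sum>v\<in>#A. replicate_mset (fst v) v)"

lemma expand_simps [simp]:
  "expand {#} = {#}"
  "expand (add_mset v A) = replicate_mset (fst v) v + expand A"
  by (simp_all add: expand_def)

lemma count_expand: "count (expand A) v = fst v * count A v"
  by (induction A) (auto simp: count_replicate_mset)

text \<open>The multiplicity of \<open>v\<close> in \<open>expand A\<close> is \<open>fst v\<close>
  times that in \<open>A\<close>. Items of length 0 would be lost and are excluded.\<close>

lemma expand_inject:
  assumes "expand A = expand B" "\<And>v. v \<in># A + B \<Longrightarrow> fst v \<ge> 1"
  shows "A = B"
proof (rule multiset_eqI)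
  fix v
  have "fst v * count A v = fst v * count B v"
    using assms(1) by (metis count_expand)
  then show "count A v = count B v"
    using assms(2)[of v] by (cases "v \<in># A + B") (auto simp: not_in_iff)
qed

section \<open>Orbits of permutations with finite support\<close>

definition orbit_of :: "('x \<Rightarrow> 'x) \<Rightarrow> 'x \<Rightarrow> 'x set" where
  "orbit_of f x = (\<lambda>i. (f ^^ i) x) ` {..<least_power f x}"

context
  fixes f :: "'x \<Rightarrow> 'x"
  assumes perm: "permutation f"
begin

lemma inj_on_orbit_of: "inj_on (\<lambda>i. (f ^^ i) x) {..<least_power f x}"
  using cycle_of_permutation[OF perm, of x] by (simp add: distinct_map atLeast_upt)

lemma card_orbit_of: "card (orbit_of f x) = least_power f x"
  by (simp add: orbit_of_def card_image inj_on_orbit_of)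

lemma orbit_of_eq_range: "orbit_of f x = range (\<lambda>i. (f ^^ i) x)"
  using support_set[OF perm, of x] by (simp add: orbit_of_def atLeast_upt)

lemma orbit_of_self: "x \<in> orbit_of f x"
  unfolding orbit_of_eq_range by (rule image_eqI[of _ _ 0]) simp_all

lemma orbit_of_closed:
  assumes "z \<in> orbit_of f x"
  shows "f z \<in> orbit_of f x"
proof -
  obtain n where "z = (f ^^ n) x" using assms unfolding orbit_of_def by blast
  then have "f z = (f ^^ Suc n) x" by simp
  then show ?thesis unfolding orbit_of_eq_range by blast
qed

lemma orbit_of_subset:
  assumes "f ` A \<subseteq> A" "x \<in> A"
  shows "orbit_of f x \<subseteq> A"
proof -
  have "(f ^^ n) x \<in> A" for n using assms by (induction n) auto
  then show ?thesis unfolding orbit_of_def by blast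
qed

text \<open>On a cycle of length \<open>Suc k\<close>, going back one step is the same as going
  forward \<open>k\<close> steps. Hence the complement of an orbit is invariant too and orbits can
  be split off one at a time.\<close>

lemma orbit_of_backward:
  assumes "f z \<in> orbit_of f x"
  shows "z \<in> orbit_of f x"
proof -
  obtain n where n: "f z = (f ^^ n) x" using assms unfolding orbit_of_def by blast
  obtain k where k: "least_power f x = Suc k"
    using least_power_of_permutation(2)[OF perm, of x] by (cases "least_power f x") auto
  have "(f ^^ Suc (n + k)) x = (f ^^ n) ((f ^^ Suc k) x)"
    by (simp add: funpow_add funpow_swap1)
  also have "\<dots> = f z" using n least_power_of_permutation(1)[OF perm, of x] k by simp
  finally have "f ((f ^^ (n + k)) x) = f z" by simp
  then have "z = (f ^^ (n + k)) x"
    using bij_is_inj perm unfolding permutation by (metis injD)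
  then show ?thesis unfolding orbit_of_eq_range by auto
qed

lemma orbit_of_Diff_closed: "f ` A \<subseteq> A \<Longrightarrow> f ` (A - orbit_of f x) \<subseteq> A - orbit_of f x"
  using orbit_of_backward by blast

end

section \<open>Intertwiners and the invariance of cycle data\<close>

context group
begin

text \<open>Conjugacy in the form \<open>h \<otimes> x = y \<otimes> h\<close>, free of inverses, is
  the shape in which intertwiners supply it and wreath products consume it.\<close>

lemma conj_class_eq_iff:
  assumes "x \<in> carrier G" "y \<in> carrier G"
  shows "conj_class G x = conj_class G y \<longleftrightarrow> (\<exists>h\<in>carrier G. h \<otimes> x = y \<otimes> h)"
proof
  assume "conj_class G x = conj_class G y"
  moreover have "y \<in> conj_class G y"
    unfolding conj_class_def using assms by (auto intro!: exI[of _ \<one>])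
  ultimately obtain h where h: "h \<in> carrier G" "y = h \<otimes> x \<otimes> inv h"
    unfolding conj_class_def by auto
  then have "h \<otimes> x = y \<otimes> h" using assms by (simp add: m_assoc)
  with h show "\<exists>h\<in>carrier G. h \<otimes> x = y \<otimes> h" by blast
next
  assume "\<exists>h\<in>carrier G. h \<otimes> x = y \<otimes> h"
  then obtain h where h: "h \<in> carrier G" "h \<otimes> x = y \<otimes> h" by blast
  have y: "y = h \<otimes> x \<otimes> inv h" using h assms by (simp add: m_assoc)
  have x: "x = inv h \<otimes> y \<otimes> h" using h assms by (metis inv_solve_left m_assoc m_closed inv_closed)
  have c: "h \<otimes> (inv h \<otimes> k) = k" if "k \<in> carrier G" for k
    using that h by (simp flip: m_assoc)
  show "conj_class G x = conj_class G y"
  proof (intro equalityI subsetI)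
    fix z assume "z \<in> conj_class G x"
    then obtain k where k: "k \<in> carrier G" "z = k \<otimes> x \<otimes> inv k"
      unfolding conj_class_def by auto
    have "z = (k \<otimes> inv h) \<otimes> y \<otimes> inv (k \<otimes> inv h)"
      unfolding k(2) by (subst x) (use k h assms in \<open>simp add: m_assoc inv_mult_group\<close>)
    then show "z \<in> conj_class G y" unfolding conj_class_def using k h by blast
  next
    fix z assume "z \<in> conj_class G y"
    then obtain k where k: "k \<in> carrier G" "z = k \<otimes> y \<otimes> inv k"
      unfolding conj_class_def by auto
    have "z = (k \<otimes> h) \<otimes> x \<otimes> inv (k \<otimes> h)"
      unfolding k(2) by (subst y) (use k h assms in \<open>simp add: m_assoc inv_mult_group c\<close>)
    then show "z \<in> conj_class G x" unfolding conj_class_def using k h by blast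
  qed
qed

lemma conj_class_one: "conj_class G \<one> = {\<one>}"
  unfolding conj_class_def by (auto intro!: exI[of _ \<one>])

lemma conj_class_self: "x \<in> carrier G \<Longrightarrow> x \<in> conj_class G x"
  unfolding conj_class_def by (auto intro!: exI[of _ \<one>])

lemma conj_class_eq_one_iff: "x \<in> carrier G \<Longrightarrow> conj_class G x = {\<one>} \<longleftrightarrow> x = \<one>"
  using conj_class_self[of x] conj_class_one by auto

lemma cocycle_closed [simp]: "(\<And>x. \<phi> x \<in> carrier G) \<Longrightarrow> cocycle G \<phi> f n x \<in> carrier G"
  by (induction n) auto

text \<open>
  The map \<open>(z, h) \<mapsto> (t z, \<theta> z h)\<close> intertwines the actions of \<open>(\<phi>, f)\<close> and \<open>(\<phi>', f')\<close> above the
  invariant set \<open>A\<close>. Conjugation, restriction to \<open>A\<close> and translation along an orbit are instances.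
\<close>

lemma cocycle_intertwine:
  assumes A: "f ` A \<subseteq> A" "z \<in> A"
    and t: "\<And>z. z \<in> A \<Longrightarrow> t (f z) = f' (t z)"
    and \<theta>: "\<And>z. z \<in> A \<Longrightarrow> \<theta> (f z) \<otimes> \<phi> (f z) = \<phi>' (t (f z)) \<otimes> \<theta> z"
    and cl: "\<And>z. \<phi> z \<in> carrier G" "\<And>z. \<phi>' z \<in> carrier G" "\<And>z. \<theta> z \<in> carrier G"
  shows "(f ^^ n) z \<in> A" "t ((f ^^ n) z) = (f' ^^ n) (t z)"
    and "\<theta> ((f ^^ n) z) \<otimes> cocycle G \<phi> f n z = cocycle G \<phi>' f' n (t z) \<otimes> \<theta> z"
proof -
  show An: "(f ^^ n) z \<in> A" for n using A by (induction n) auto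
  show tn: "t ((f ^^ n) z) = (f' ^^ n) (t z)" for n
    by (induction n) (simp_all add: t[OF An])
  show "\<theta> ((f ^^ n) z) \<otimes> cocycle G \<phi> f n z = cocycle G \<phi>' f' n (t z) \<otimes> \<theta> z"
  proof (induction n)
    case 0
    show ?case using cl by simp
  next
    case (Suc n)
    let ?y = "(f ^^ n) z"
    have "\<theta> (f ?y) \<otimes> (\<phi> (f ?y) \<otimes> cocycle G \<phi> f n z) = \<theta> (f ?y) \<otimes> \<phi> (f ?y) \<otimes> cocycle G \<phi> f n z"
      using cl by (simp add: m_assoc)
    also have "\<dots> = \<phi>' (t (f ?y)) \<otimes> (\<theta> ?y \<otimes> cocycle G \<phi> f n z)"
      unfolding \<theta>[OF An] using cl by (simp add: m_assoc)
    also have "\<dots> = \<phi>' (t (f ?y)) \<otimes> cocycle G \<phi>' f' n (t z) \<otimes> \<theta> z"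
      unfolding Suc using cl by (simp add: m_assoc)
    finally show ?case using tn[of "Suc n"] by simp
  qed
qed

text \<open>Injectivity of \<open>t\<close> makes the two cycles close up at the same time, and at
  that moment the relation between the cocycles says that \<open>\<theta> z\<close> conjugates one
  cycle product into the other.\<close>

lemma cycle_data_intertwine:
  assumes "permutation f" and A: "f ` A \<subseteq> A" "z \<in> A" and inj: "inj_on t A"
    and t: "\<And>z. z \<in> A \<Longrightarrow> t (f z) = f' (t z)"
    and \<theta>: "\<And>z. z \<in> A \<Longrightarrow> \<theta> (f z) \<otimes> \<phi> (f z) = \<phi>' (t (f z)) \<otimes> \<theta> z"
    and cl: "\<And>z. \<phi> z \<in> carrier G" "\<And>z. \<phi>' z \<in> carrier G" "\<And>z. \<theta> z \<in> carrier G"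
  shows "cycle_data G \<phi>' f' (t z) = cycle_data G \<phi> f z"
proof -
  note ci = cocycle_intertwine[where f = f and A = A and z = z and t = t and f' = f' and \<theta> = \<theta>
      and \<phi> = \<phi> and \<phi>' = \<phi>', OF A t \<theta> cl]
  have "(f' ^^ n) (t z) = t z \<longleftrightarrow> (f ^^ n) z = z" for n
    using ci(1,2)[of n] A(2) inj by (metis inj_on_eq_iff)
  then have lp: "least_power f' (t z) = least_power f z"
    unfolding least_power_def by simp
  have "\<theta> z \<otimes> cocycle G \<phi> f (least_power f z) z = cocycle G \<phi>' f' (least_power f z) (t z) \<otimes> \<theta> z"
    using ci(3)[of "least_power f z"] least_power_of_permutation(1)[OF assms(1), of z] by simp
  then have "conj_class G (cocycle G \<phi> f (least_power f z) z) =
      conj_class G (cocycle G \<phi>' f' (least_power f z) (t z))"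
    using cl by (subst conj_class_eq_iff) auto
  then show ?thesis unfolding cycle_data_def lp by simp
qed

lemma cycle_data_cong:
  assumes "permutation f" "f ` A \<subseteq> A" "z \<in> A"
    and "\<And>z. z \<in> A \<Longrightarrow> f' z = f z" "\<And>z. z \<in> A \<Longrightarrow> \<phi>' z = \<phi> z"
    and "\<And>z. \<phi> z \<in> carrier G" "\<And>z. \<phi>' z \<in> carrier G"
  shows "cycle_data G \<phi>' f' z = cycle_data G \<phi> f z"
  using assms
  by (intro cycle_data_intertwine[where t = "\<lambda>z. z" and \<theta> = "\<lambda>_. \<one>" and A = A]) (auto simp: image_subset_iff)

lemma cycle_data_orbit:
  assumes "permutation f" "\<And>z. \<phi> z \<in> carrier G" "z \<in> orbit_of f x"
  shows "cycle_data G \<phi> f z = cycle_data G \<phi> f x"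
proof -
  \<comment> \<open>The translation \<open>t = f\<close> is an intertwiner of
    \<open>(\<phi>, f)\<close> with itself when \<open>\<theta> z = \<phi> (f z)\<close>: the
    required relation becomes an identity.\<close>
  have step: "cycle_data G \<phi> f (f z) = cycle_data G \<phi> f z" for z
    using assms(1,2) permutation_bijective[OF assms(1)]
    by (intro cycle_data_intertwine[where A = UNIV and \<theta> = "\<lambda>z. \<phi> (f z)"]) (auto simp: bij_is_inj)
  have "cycle_data G \<phi> f ((f ^^ n) x) = cycle_data G \<phi> f x" for n
    by (induction n) (simp_all add: step)
  then show ?thesis using assms(3) unfolding orbit_of_def by blast
qed

lemma fst_cycle_data: "permutation f \<Longrightarrow> fst (cycle_data G \<phi> f x) \<ge> 1"
  using least_power_of_permutation(2)[of f x] by (simp add: cycle_data_def)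

text \<open>The data are constant on the orbit of \<open>x\<close>, and their first component is its
  size; this is the block that \<open>expand\<close> produces for one cycle.\<close>

lemma image_cycle_data_split_orbit:
  assumes "permutation f" "\<And>z. \<phi> z \<in> carrier G" "finite A" "f ` A \<subseteq> A" "x \<in> A"
  defines "d \<equiv> cycle_data G \<phi> f"
  shows "image_mset d (mset_set A) = replicate_mset (fst (d x)) (d x) + image_mset d (mset_set (A - orbit_of f x))"
proof -
  let ?O = "orbit_of f x"
  have sub: "?O \<subseteq> A" using orbit_of_subset assms by metis
  have "mset_set A = mset_set ?O + mset_set (A - ?O)"
    using sub assms(3) by (metis Diff_disjoint Un_Diff_cancel finite_Diff finite_subset mset_set_Union sup.absorb2)
  moreover have "image_mset d (mset_set ?O) = image_mset (\<lambda>_. d x) (mset_set ?O)"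
    unfolding d_def using cycle_data_orbit[where \<phi> = \<phi>, OF assms(1,2)] assms(3) finite_subset[OF sub]
    by (intro image_mset_cong) auto
  moreover have "card ?O = fst (d x)"
    using card_orbit_of[OF assms(1)] by (simp add: d_def cycle_data_def)
  ultimately show ?thesis by (simp add: image_mset_const_eq)
qed

lemma cycle_data_decomp:
  assumes "permutation f" "\<And>z. \<phi> z \<in> carrier G" "finite A" "f ` A \<subseteq> A"
  shows "\<exists>B. set_mset B \<subseteq> cycle_data G \<phi> f ` A \<and> image_mset (cycle_data G \<phi> f) (mset_set A) = expand B"
  using assms(3,4)
proof (induction A rule: finite_psubset_induct)
  case (psubset A)
  show ?case
  proof (cases "A = {}")
    case True
    then show ?thesis by (auto intro: exI[of _ "{#}"])
  next
    case False
    then obtain x where x: "x \<in> A" by blast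
    let ?O = "orbit_of f x" and ?d = "cycle_data G \<phi> f"
    have "A - ?O \<subset> A" using x orbit_of_self[OF assms(1), of x] by blast
    then obtain B where "set_mset B \<subseteq> ?d ` (A - ?O)" "image_mset ?d (mset_set (A - ?O)) = expand B"
      using psubset.IH orbit_of_Diff_closed[OF assms(1) psubset.prems] by meson
    then show ?thesis
      using x image_cycle_data_split_orbit[OF assms(1,2) psubset.hyps psubset.prems x]
      by (intro exI[of _ "add_mset (?d x) B"]) auto
  qed
qed

text \<open>Match the two cycles point by point, starting at \<open>x\<close> and \<open>x'\<close>.
  The value \<open>a\<close> of \<open>\<theta>\<close> at \<open>x\<close> then forces all other
  values, and the last step back to \<open>x\<close> is consistent precisely because
  \<open>a\<close> conjugates the cycle products.\<close>

lemma orbit_intertwiner: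
  assumes f: "permutation f" "permutation f'"
    and cl: "\<And>z. \<phi> z \<in> carrier G" "\<And>z. \<phi>' z \<in> carrier G"
    and d: "cycle_data G \<phi> f x = cycle_data G \<phi>' f' x'"
  shows "\<exists>t \<theta>. bij_betw t (orbit_of f x) (orbit_of f' x') \<and> (\<forall>z. \<theta> z \<in> carrier G) \<and>
    (\<forall>z\<in>orbit_of f x. t (f z) = f' (t z) \<and> \<theta> (f z) \<otimes> \<phi> (f z) = \<phi>' (t (f z)) \<otimes> \<theta> z)"
proof -
  define k where "k = least_power f x"
  define e where "e = (\<lambda>i. (f ^^ i) x)"
  define e' where "e' = (\<lambda>i. (f' ^^ i) x')"
  define j where "j = inv_into {..<k} e"
  let ?P = "\<lambda>n. cocycle G \<phi> f n x" and ?P' = "\<lambda>n. cocycle G \<phi>' f' n x'"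
  have k': "least_power f' x' = k" using d by (simp add: cycle_data_def k_def)
  have k: "(f ^^ k) x = x" "(f' ^^ k) x' = x'" "k > 0"
    using least_power_of_permutation[OF f(1), of x] least_power_of_permutation[OF f(2), of x'] k'
    by (simp_all add: k_def)
  have be: "bij_betw e {..<k} (orbit_of f x)" "bij_betw e' {..<k} (orbit_of f' x')"
    using inj_on_orbit_of[OF f(1), of x] inj_on_orbit_of[OF f(2), of x'] k'
    by (simp_all add: bij_betw_def e_def e'_def k_def orbit_of_def)
  have je: "j (e i) = i" if "i < k" for i
    unfolding j_def using be(1) that by (auto simp: bij_betw_def)
  have "conj_class G (?P k) = conj_class G (?P' k)"
    using d k' by (simp add: cycle_data_def k_def)
  then obtain a where a: "a \<in> carrier G" "a \<otimes> ?P k = ?P' k \<otimes> a"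
    using cl by (subst (asm) conj_class_eq_iff) auto
  \<comment> \<open>The solution of the intertwining recursion along the cycle with initial value
    \<open>a\<close>; \<open>j z\<close> is the position of \<open>z\<close> on its cycle.\<close>
  define \<theta> where "\<theta> = (\<lambda>z. ?P' (j z) \<otimes> a \<otimes> inv (?P (j z)))"
  have main: "(e' \<circ> j) (f z) = f' ((e' \<circ> j) z) \<and> \<theta> (f z) \<otimes> \<phi> (f z) = \<phi>' ((e' \<circ> j) (f z)) \<otimes> \<theta> z"
    if z: "z \<in> orbit_of f x" for z
  proof -
    obtain i where i: "i < k" "z = e i" using z unfolding k_def e_def orbit_of_def by blast
    have fz: "f (e i) = e (Suc i)" by (simp add: e_def)
    show ?thesis
    proof (cases "Suc i < k")
      case True
      have "inv (?P (Suc i)) \<otimes> \<phi> (e (Suc i)) = inv (?P i)"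
      proof -
        have "?P (Suc i) = \<phi> (e (Suc i)) \<otimes> ?P i" by (simp add: e_def)
        then show ?thesis using cl by (simp add: inv_mult_group m_assoc)
      qed
      moreover have "?P' (Suc i) = \<phi>' (e' (Suc i)) \<otimes> ?P' i" by (simp add: e'_def)
      ultimately show ?thesis
        using cl a(1) i True unfolding \<theta>_def comp_def fz je[OF i(1)] i(2) je[OF True] 
        by (simp add: m_assoc del: cocycle.simps) (simp add: e'_def)
    next
      \<comment> \<open>Here the step wraps around to \<open>e 0\<close>, and the choice of
        \<open>a\<close> is used.\<close>
      case False
      then have ik: "k = Suc i" using i by simp
      have e0: "e (Suc i) = e 0" using k(1) unfolding ik by (simp add: e_def)
      have e'0: "e' (Suc i) = e' 0" using k(2) unfolding ik by (simp add: e'_def)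
      have P: "?P k = \<phi> (e 0) \<otimes> ?P i" "?P' k = \<phi>' (e' 0) \<otimes> ?P' i"
        unfolding ik using e0 e'0 by (simp_all add: e_def e'_def)
      have "\<phi>' (e' 0) \<otimes> (?P' i \<otimes> a \<otimes> inv (?P i)) = a \<otimes> ?P k \<otimes> inv (?P i)"
        unfolding a(2) unfolding P using cl a(1) by (simp add: m_assoc)
      also have "\<dots> = a \<otimes> \<phi> (e 0)" unfolding P using cl a(1) by (simp add: m_assoc)
      finally have "\<phi>' (e' 0) \<otimes> (?P' i \<otimes> a \<otimes> inv (?P i)) = a \<otimes> \<phi> (e 0)" .
      moreover have "f' (e' i) = e' 0" using e'0 by (simp add: e'_def)
      ultimately show ?thesis
        using cl a(1) unfolding \<theta>_def comp_def fz e0 je[OF k(3)] i(2) je[OF i(1)] by simp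
    qed
  qed
  have "bij_betw (e' \<circ> j) (orbit_of f x) (orbit_of f' x')"
    using be unfolding j_def by (intro bij_betw_trans[OF bij_betw_inv_into])
  moreover have "\<theta> z \<in> carrier G" for z unfolding \<theta>_def using cl a by simp
  ultimately show ?thesis using main by (intro exI[of _ "e' \<circ> j"] exI[of _ \<theta>]) blast
qed

text \<open>Equal multisets of data allow an orbit in \<open>A\<close> to be matched with one of the
  same data in \<open>A'\<close>. Removing both leaves equal multisets, and the pieces glue because
  \<open>f\<close> maps orbit and complement to themselves.\<close>

lemma exists_intertwiner:
  assumes f: "permutation f" "permutation f'"
    and cl: "\<And>z. \<phi> z \<in> carrier G" "\<And>z. \<phi>' z \<in> carrier G"
    and "finite A" "finite A'" "f ` A \<subseteq> A" "f' ` A' \<subseteq> A'"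
    and "image_mset (cycle_data G \<phi> f) (mset_set A) = image_mset (cycle_data G \<phi>' f') (mset_set A')"
  shows "\<exists>t \<theta>. bij_betw t A A' \<and> (\<forall>z. \<theta> z \<in> carrier G) \<and>
    (\<forall>z\<in>A. t (f z) = f' (t z) \<and> \<theta> (f z) \<otimes> \<phi> (f z) = \<phi>' (t (f z)) \<otimes> \<theta> z)"
  using assms(5-9)
proof (induction A arbitrary: A' rule: finite_psubset_induct)
  case (psubset A)
  let ?d = "cycle_data G \<phi> f" and ?d' = "cycle_data G \<phi>' f'"
  show ?case
  proof (cases "A = {}")
    case True
    then have "A' = {}" using psubset.prems by (simp add: mset_set_empty_iff)
    with True show ?thesis
      by - (rule exI[where x = undefined], rule exI[where x = "\<lambda>_. \<one>"], simp add: bij_betw_def)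
  next
    case False
    then obtain x where x: "x \<in> A" by blast
    have "?d x \<in> set_mset (image_mset ?d (mset_set A))" using x psubset.hyps by simp
    then have "?d x \<in> ?d' ` A'" using psubset.prems by simp
    then obtain x' where x': "x' \<in> A'" "?d x = ?d' x'" by blast
    let ?O = "orbit_of f x" and ?O' = "orbit_of f' x'"
    have sub: "?O \<subseteq> A" "?O' \<subseteq> A'"
      using orbit_of_subset[OF f(1) psubset.prems(2) x] orbit_of_subset[OF f(2) psubset.prems(3) x'(1)] .
    have "A - ?O \<subset> A" using x orbit_of_self[OF f(1), of x] by blast
    moreover have "image_mset ?d (mset_set (A - ?O)) = image_mset ?d' (mset_set (A' - ?O'))"
      using image_cycle_data_split_orbit[OF f(1) cl(1) psubset.hyps psubset.prems(2) x]
        image_cycle_data_split_orbit[OF f(2) cl(2) psubset.prems(1,3) x'(1)]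
        psubset.prems(4) x'(2) by simp
    ultimately obtain t1 \<theta>1 where 1: "bij_betw t1 (A - ?O) (A' - ?O')" "\<And>z. \<theta>1 z \<in> carrier G"
      "\<And>z. z \<in> A - ?O \<Longrightarrow> t1 (f z) = f' (t1 z) \<and> \<theta>1 (f z) \<otimes> \<phi> (f z) = \<phi>' (t1 (f z)) \<otimes> \<theta>1 z"
      using psubset.IH[of "A - ?O" "A' - ?O'"] orbit_of_Diff_closed[OF f(1) psubset.prems(2)]
        orbit_of_Diff_closed[OF f(2) psubset.prems(3)] psubset.prems(1) by (metis (lifting) finite_Diff)
    obtain t2 \<theta>2 where 2: "bij_betw t2 ?O ?O'" "\<And>z. \<theta>2 z \<in> carrier G"
      "\<And>z. z \<in> ?O \<Longrightarrow> t2 (f z) = f' (t2 z) \<and> \<theta>2 (f z) \<otimes> \<phi> (f z) = \<phi>' (t2 (f z)) \<otimes> \<theta>2 z"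
      using orbit_intertwiner[where f = f and f' = f' and \<phi> = \<phi> and \<phi>' = \<phi>', OF f cl x'(2)] by metis
    define t where "t = (\<lambda>z. if z \<in> ?O then t2 z else t1 z)"
    define \<theta> where "\<theta> = (\<lambda>z. if z \<in> ?O then \<theta>2 z else \<theta>1 z)"
    have "bij_betw t (?O \<union> (A - ?O)) (?O' \<union> (A' - ?O'))"
      unfolding t_def using bij_betw_disjoint_Un[OF 2(1) 1(1)] by auto
    then have "bij_betw t A A'" using sub by (simp add: Un_absorb1)
    moreover have "t (f z) = f' (t z) \<and> \<theta> (f z) \<otimes> \<phi> (f z) = \<phi>' (t (f z)) \<otimes> \<theta> z" if "z \<in> A" for z
    proof (cases "z \<in> ?O")
      case True
      then show ?thesis using 2(3)[of z] orbit_of_closed[OF f(1) True] by (simp only: t_def \<theta>_def if_True)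
    next
      case False
      then have "f z \<notin> ?O" using orbit_of_backward[OF f(1)] by blast
      then show ?thesis using 1(3)[OF DiffI[OF that False]] False by (simp only: t_def \<theta>_def if_False)
    qed
    moreover have "\<theta> z \<in> carrier G" for z using 1(2) 2(2) by (simp add: \<theta>_def)
    ultimately show ?thesis by blast
  qed
qed

end

section \<open>Conjugacy in wreath products\<close>

text \<open>Restricting to the points that are moved or carry a nontrivial value keeps the index set
  finite; on an infinite \<open>X\<close> the trivial points would occur infinitely often.\<close>

definition cycle_type :: "('a, 'b) monoid_scheme \<Rightarrow> ('x \<Rightarrow> 'a) \<times> ('x \<Rightarrow> 'x) \<Rightarrow> (nat \<times> 'a set) multiset" where
  "cycle_type H g = (case g of (\<phi>, f) \<Rightarrow>
     image_mset (cycle_data H \<phi> f) (mset_set {x. f x \<noteq> x \<or> \<phi> x \<noteq> \<one>\<^bsub>H\<^esub>}))"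

lemma finitary_perms_permutation: "f \<in> finitary_perms X \<Longrightarrow> permutation f"
  unfolding finitary_perms_def permutation using permutes_bij by blast

lemma finitary_perms_comp:
  assumes "f \<in> finitary_perms X" "g \<in> finitary_perms X"
  shows "f \<circ> g \<in> finitary_perms X"
proof -
  have "{x. (f \<circ> g) x \<noteq> x} \<subseteq> {x. f x \<noteq> x} \<union> {x. g x \<noteq> x}" by auto
  then show ?thesis
    using assms unfolding finitary_perms_def by (auto intro: permutes_compose finite_subset)
qed

lemma finitary_perms_inv:
  assumes "f \<in> finitary_perms X"
  shows "inv_into UNIV f \<in> finitary_perms X"
proof -
  have p: "f permutes X" "finite {x. f x \<noteq> x}" using assms by (auto simp: finitary_perms_def)
  have "{x. inv_into UNIV f x \<noteq> x} = {x. f x \<noteq> x}"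
    using p(1) by (metis permutes_inv_eq)
  then show ?thesis
    using p permutes_inv[OF p(1)] by (simp add: finitary_perms_def)
qed

lemma transpose_finitary_perms:
  assumes "x \<in> X" "y \<in> X"
  shows "Transposition.transpose x y \<in> finitary_perms X"
proof -
  have "{z. Transposition.transpose x y z \<noteq> z} \<subseteq> {x, y}" by (auto simp: Transposition.transpose_def)
  then show ?thesis
    unfolding finitary_perms_def using assms by (auto intro: permutes_swap_id finite_subset)
qed

lemma moved_closed:
  assumes "f permutes X"
  shows "f ` {x. f x \<noteq> x \<or> P x} \<subseteq> {x. f x \<noteq> x \<or> P x}"
proof -
  have "f x \<in> {x. f x \<noteq> x \<or> P x}" if "x \<in> {x. f x \<noteq> x \<or> P x}" for x
    using that permutes_inj[OF assms] by (cases "f x = x") (auto dest: injD)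
  then show ?thesis by blast
qed

section \<open>The group structure of the wreath product and the classification of its conjugacy
  classes\<close>

context group
begin

abbreviation "W X \<equiv> wreath G X"

lemma mult_wreath: "(\<phi>, f) \<otimes>\<^bsub>W X\<^esub> (\<psi>, g) = (\<lambda>x. \<phi> x \<otimes> \<psi> (inv_into UNIV f x), f \<circ> g)"
  by (simp add: wreath_def)

lemma one_wreath: "\<one>\<^bsub>W X\<^esub> = (\<lambda>_. \<one>, id)"
  by (simp add: wreath_def)

lemma carrier_wreath: "carrier (W X) = finsupp_funs G X \<times> finitary_perms X"
  by (simp add: wreath_def)

lemma wreath_mult_closed:
  assumes "g \<in> carrier (W X)" "h \<in> carrier (W X)"
  shows "g \<otimes>\<^bsub>W X\<^esub> h \<in> carrier (W X)"
proof -
  obtain \<phi> f \<psi> k where gh: "g = (\<phi>, f)" "h = (\<psi>, k)" by (metis surj_pair)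
  have c: "\<phi> \<in> finsupp_funs G X" "\<psi> \<in> finsupp_funs G X" "f \<in> finitary_perms X" "k \<in> finitary_perms X"
    using assms unfolding gh carrier_wreath by auto
  have p: "f permutes X" using c by (simp add: finitary_perms_def)
  have "{x. \<phi> x \<otimes> \<psi> (inv_into UNIV f x) \<noteq> \<one>} \<subseteq> {x. \<phi> x \<noteq> \<one>} \<union> f ` {x. \<psi> x \<noteq> \<one>}"
  proof
    fix x assume "x \<in> {x. \<phi> x \<otimes> \<psi> (inv_into UNIV f x) \<noteq> \<one>}"
    then have "\<phi> x \<noteq> \<one> \<or> \<psi> (inv_into UNIV f x) \<noteq> \<one>" by auto
    moreover have "f (inv_into UNIV f x) = x" using p by (simp add: permutes_inverses(1))
    ultimately show "x \<in> {x. \<phi> x \<noteq> \<one>} \<union> f ` {x. \<psi> x \<noteq> \<one>}"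
      by (metis (mono_tags, lifting) UnCI imageI mem_Collect_eq)
  qed
  moreover have "f ` {x. \<psi> x \<noteq> \<one>} \<subseteq> X"
    using c(2) p permutes_image[OF p] unfolding finsupp_funs_def by blast
  moreover have "{x. \<phi> x \<noteq> \<one>} \<subseteq> X" "finite ({x. \<phi> x \<noteq> \<one>} \<union> f ` {x. \<psi> x \<noteq> \<one>})"
    using c(1,2) unfolding finsupp_funs_def by auto
  ultimately have "{x. \<phi> x \<otimes> \<psi> (inv_into UNIV f x) \<noteq> \<one>} \<subseteq> X"
    "finite {x. \<phi> x \<otimes> \<psi> (inv_into UNIV f x) \<noteq> \<one>}"
    by (blast, metis (lifting) finite_subset)
  then have "(\<lambda>x. \<phi> x \<otimes> \<psi> (inv_into UNIV f x)) \<in> finsupp_funs G X"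
    using c(1,2) unfolding finsupp_funs_def by auto
  then show ?thesis
    unfolding gh mult_wreath carrier_wreath using c by (auto intro: finitary_perms_comp)
qed

lemma group_wreath: "group (W X)"
proof (rule groupI)
  show "\<one>\<^bsub>W X\<^esub> \<in> carrier (W X)"
    by (simp add: one_wreath carrier_wreath finsupp_funs_def finitary_perms_def)
next
  fix g h k assume "g \<in> carrier (W X)" "h \<in> carrier (W X)" "k \<in> carrier (W X)"
  then show "g \<otimes>\<^bsub>W X\<^esub> h \<otimes>\<^bsub>W X\<^esub> k = g \<otimes>\<^bsub>W X\<^esub> (h \<otimes>\<^bsub>W X\<^esub> k)"
    unfolding carrier_wreath
    by (cases g; cases h; cases k)
      (auto simp: mult_wreath finsupp_funs_def finitary_perms_def m_assoc o_inv_distrib permutes_bij fun_eq_iff)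
next
  fix g assume "g \<in> carrier (W X)"
  then show "\<one>\<^bsub>W X\<^esub> \<otimes>\<^bsub>W X\<^esub> g = g"
    unfolding carrier_wreath by (cases g) (auto simp: one_wreath mult_wreath finsupp_funs_def inv_id)
next
  fix g assume g: "g \<in> carrier (W X)"
  obtain \<phi> f where gf: "g = (\<phi>, f)" by (metis surj_pair)
  have c: "\<phi> \<in> finsupp_funs G X" "f \<in> finitary_perms X" and p: "f permutes X"
    using g unfolding gf carrier_wreath finitary_perms_def by auto
  have eq: "{x. inv (\<phi> (f x)) \<noteq> \<one>} = inv_into UNIV f ` {x. \<phi> x \<noteq> \<one>}"
  proof -
    have "inv (\<phi> (f x)) \<noteq> \<one> \<longleftrightarrow> \<phi> (f x) \<noteq> \<one>" for x
      using c(1) unfolding finsupp_funs_def by (metis (mono_tags, lifting) inv_inv inv_one mem_Collect_eq)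
    moreover have "{x. \<phi> (f x) \<noteq> \<one>} = inv_into UNIV f ` {x. \<phi> x \<noteq> \<one>}"
      using permutes_inverses[OF p] by (auto simp: image_iff) metis
    ultimately show ?thesis by simp
  qed
  have "inv_into UNIV f ` {x. \<phi> x \<noteq> \<one>} \<subseteq> X"
    using c(1) permutes_image[OF permutes_inv[OF p]] unfolding finsupp_funs_def by blast
  then have "(\<lambda>x. inv (\<phi> (f x))) \<in> finsupp_funs G X"
    using c(1) eq unfolding finsupp_funs_def by auto
  moreover have "inv_into UNIV (inv_into UNIV f) = f"
    using p by (simp add: permutes_inv_inv)
  \<comment> \<open>The inverse of \<open>(\<phi>, f)\<close> has second component the inverse of
    \<open>f\<close>, and its values must cancel \<open>\<phi>\<close> shifted by
    \<open>f\<close>.\<close>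
  ultimately show "\<exists>h\<in>carrier (W X). h \<otimes>\<^bsub>W X\<^esub> g = \<one>\<^bsub>W X\<^esub>"
    using c permutes_inv_o(2)[OF p]
    by (intro bexI[of _ "(\<lambda>x. inv (\<phi> (f x)), inv_into UNIV f)"])
      (auto simp: gf mult_wreath one_wreath carrier_wreath finitary_perms_inv finsupp_funs_def)
qed (rule wreath_mult_closed)

lemma wreath_carrierD:
  assumes "(\<phi>, f) \<in> carrier (W X)"
  shows "\<phi> z \<in> carrier G" "permutation f" "f permutes X" "finite {x. f x \<noteq> x \<or> \<phi> x \<noteq> \<one>}"
    "z \<notin> X \<Longrightarrow> \<phi> z = \<one>"
proof -
  have c: "\<phi> \<in> finsupp_funs G X" "f \<in> finitary_perms X"
    using assms unfolding carrier_wreath by auto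
  show "\<phi> z \<in> carrier G" "permutation f" "f permutes X" "z \<notin> X \<Longrightarrow> \<phi> z = \<one>"
    using c finitary_perms_permutation[OF c(2)] by (auto simp: finsupp_funs_def finitary_perms_def)
  show "finite {x. f x \<noteq> x \<or> \<phi> x \<noteq> \<one>}"
    unfolding Collect_disj_eq using c by (simp add: finsupp_funs_def finitary_perms_def)
qed

text \<open>Trivial points are recognised by their data alone. An intertwiner therefore carries
  supports to supports.\<close>

lemma cycle_data_trivial_iff:
  assumes "permutation f" "\<And>z. \<phi> z \<in> carrier G"
  shows "cycle_data G \<phi> f x = (1, {\<one>}) \<longleftrightarrow> f x = x \<and> \<phi> x = \<one>"
proof -
  have "least_power f x = 1 \<longleftrightarrow> f x = x"
    using least_power_of_permutation(1)[OF assms(1), of x] least_power_le[of 1 f x]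
      least_power_of_permutation(2)[OF assms(1), of x] by auto
  moreover have "cocycle G \<phi> f 1 x = \<phi> (f x)" using assms(2) by simp
  ultimately show ?thesis
    unfolding cycle_data_def using assms(2) conj_class_eq_one_iff[of "cocycle G \<phi> f 1 x"]
    by auto
qed

text \<open>The number of padding entries depends only on \<open>card Y\<close> and the cycle type,
  so elements of equal cycle type have equal data on any finite set containing both
  supports.\<close>

lemma image_cycle_data_superset:
  assumes "permutation f" "\<And>z. \<phi> z \<in> carrier G" "finite Y" "{x. f x \<noteq> x \<or> \<phi> x \<noteq> \<one>} \<subseteq> Y"
  shows "image_mset (cycle_data G \<phi> f) (mset_set Y) = cycle_type G (\<phi>, f) +
    replicate_mset (card Y - size (cycle_type G (\<phi>, f))) (1, {\<one>})"
proof -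
  let ?d = "cycle_data G \<phi> f" and ?B = "{x. f x \<noteq> x \<or> \<phi> x \<noteq> \<one>}"
  have fB: "finite ?B" using assms(3,4) by (rule rev_finite_subset)
  have "mset_set (?B \<union> (Y - ?B)) = mset_set ?B + mset_set (Y - ?B)"
    using fB assms(3) by (intro mset_set_Union) blast+
  moreover have "?B \<union> (Y - ?B) = Y" using assms(4) by blast
  moreover have "image_mset ?d (mset_set (Y - ?B)) = image_mset (\<lambda>_. (1, {\<one>})) (mset_set (Y - ?B))"
    using cycle_data_trivial_iff[where \<phi> = \<phi>, OF assms(1,2)] assms(3)
    by (intro image_mset_cong) auto
  moreover have "card (Y - ?B) = card Y - size (cycle_type G (\<phi>, f))"
    using card_Diff_subset[OF fB assms(4)] by (simp add: cycle_type_def)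
  ultimately show ?thesis by (simp only: image_mset_const_eq cycle_type_def prod.case image_mset_union size_mset_set)
qed

text \<open>Read componentwise, the equation says that \<open>t\<close> intertwines \<open>f\<close>
  and \<open>f'\<close>, and, evaluated at \<open>t (f z)\<close>, that
  \<open>\<theta> z = \<eta> (t z)\<close> satisfies the relation for the values.\<close>

lemma cycle_type_intertwine:
  assumes g: "(\<phi>, f) \<in> carrier (W X)" and g': "(\<phi>', f') \<in> carrier (W X)" and h: "(\<eta>, t) \<in> carrier (W X)"
    and eq: "(\<eta>, t) \<otimes>\<^bsub>W X\<^esub> (\<phi>, f) = (\<phi>', f') \<otimes>\<^bsub>W X\<^esub> (\<eta>, t)"
  shows "cycle_type G (\<phi>, f) = cycle_type G (\<phi>', f')"
proof -
  note c = wreath_carrierD[OF g] and c' = wreath_carrierD[OF g'] and ch = wreath_carrierD[OF h]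
  have bt: "bij t" using ch(3) permutes_bij by blast
  have tf: "t (f z) = f' (t z)" for z using eq by (auto simp: mult_wreath fun_eq_iff)
  have e: "\<eta> x \<otimes> \<phi> (inv_into UNIV t x) = \<phi>' x \<otimes> \<eta> (inv_into UNIV f' x)" for x
    using eq by (auto simp: mult_wreath fun_eq_iff)
  have th: "\<eta> (t (f z)) \<otimes> \<phi> (f z) = \<phi>' (t (f z)) \<otimes> \<eta> (t z)" for z
  proof -
    have "inv_into UNIV f' (t (f z)) = t z"
      unfolding tf by (rule permutes_inverses(2)[OF c'(3)])
    then show ?thesis
      using e[of "t (f z)"] by (simp only: permutes_inverses(2)[OF ch(3)])
  qed
  have d: "cycle_data G \<phi>' f' (t z) = cycle_data G \<phi> f z" for z
    by (rule cycle_data_intertwine[where A = UNIV and \<theta> = "\<lambda>z. \<eta> (t z)"])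
      (use c(1,2) c'(1) ch(1) tf th bt in \<open>auto simp: bij_is_inj\<close>)
  have "{x. f' x \<noteq> x \<or> \<phi>' x \<noteq> \<one>} = t ` {x. f x \<noteq> x \<or> \<phi> x \<noteq> \<one>}"
  proof -
    have "f' (t z) \<noteq> t z \<or> \<phi>' (t z) \<noteq> \<one> \<longleftrightarrow> f z \<noteq> z \<or> \<phi> z \<noteq> \<one>" for z
      using d[of z] cycle_data_trivial_iff[where \<phi> = \<phi>, OF c(2) c(1), of z]
        cycle_data_trivial_iff[where \<phi> = \<phi>', OF c'(2) c'(1), of "t z"] by metis
    then show ?thesis using bt by (auto simp: image_iff) (metis bij_pointE)+
  qed
  then have "cycle_type G (\<phi>', f') = image_mset (cycle_data G \<phi>' f') (image_mset t (mset_set {x. f x \<noteq> x \<or> \<phi> x \<noteq> \<one>}))"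
    using image_mset_mset_set[OF inj_on_subset[OF bij_is_inj[OF bt] subset_UNIV]]
    by (simp only: cycle_type_def prod.case)
  then show ?thesis by (simp add: cycle_type_def multiset.map_comp comp_def d)
qed

text \<open>The supports may differ, so the intertwiner is built on their union \<open>Y\<close>.
  Extended trivially outside the finite set \<open>Y\<close>, it is an element of the wreath
  product.\<close>

lemma cycle_type_eq_imp_intertwine:
  assumes g: "(\<phi>, f) \<in> carrier (W X)" and g': "(\<phi>', f') \<in> carrier (W X)"
    and eq: "cycle_type G (\<phi>, f) = cycle_type G (\<phi>', f')"
  shows "\<exists>h\<in>carrier (W X). h \<otimes>\<^bsub>W X\<^esub> (\<phi>, f) = (\<phi>', f') \<otimes>\<^bsub>W X\<^esub> h"
proof -
  note c = wreath_carrierD[OF g] and c' = wreath_carrierD[OF g']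
  let ?B = "{x. f x \<noteq> x \<or> \<phi> x \<noteq> \<one>}" and ?B' = "{x. f' x \<noteq> x \<or> \<phi>' x \<noteq> \<one>}"
  define Y where "Y = ?B \<union> ?B'"
  have Y: "finite Y" "?B \<subseteq> Y" "?B' \<subseteq> Y" using c(4) c'(4) by (auto simp: Y_def)
  have YX: "Y \<subseteq> X"
  proof
    fix z assume "z \<in> Y"
    then show "z \<in> X"
      using c(5)[of z] c'(5)[of z] permutes_not_in[OF c(3), of z] permutes_not_in[OF c'(3), of z]
      by (auto simp: Y_def)
  qed
  have inv: "k ` Y \<subseteq> Y" if "k permutes X" "{x. k x \<noteq> x} \<subseteq> Y" for k
  proof safe
    fix z assume "z \<in> Y"
    then show "k z \<in> Y" using that by (cases "k z = z") (auto dest: permutes_inj injD)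
  qed
  have "f ` Y \<subseteq> Y" "f' ` Y \<subseteq> Y" using Y by (blast intro!: inv[OF c(3)] inv[OF c'(3)])+
  moreover have "image_mset (cycle_data G \<phi> f) (mset_set Y) = image_mset (cycle_data G \<phi>' f') (mset_set Y)"
    using image_cycle_data_superset[where \<phi> = \<phi>, OF c(2) c(1) Y(1,2)]
      image_cycle_data_superset[where \<phi> = \<phi>', OF c'(2) c'(1) Y(1,3)] eq by simp
  ultimately obtain t0 \<theta> where t0: "bij_betw t0 Y Y" and th: "\<And>z. \<theta> z \<in> carrier G"
    and t0f: "\<And>z. z \<in> Y \<Longrightarrow> t0 (f z) = f' (t0 z)"
    and thf: "\<And>z. z \<in> Y \<Longrightarrow> \<theta> (f z) \<otimes> \<phi> (f z) = \<phi>' (t0 (f z)) \<otimes> \<theta> z"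
    using exists_intertwiner[where \<phi> = \<phi> and \<phi>' = \<phi>', OF c(2) c'(2) c(1) c'(1) Y(1) Y(1)] by blast
  define t where "t = (\<lambda>z. if z \<in> Y then t0 z else z)"
  define \<zeta> where "\<zeta> = (\<lambda>z. if z \<in> Y then \<theta> z else \<one>)"
  have tY: "t permutes Y"
    using t0 by (intro bij_imp_permutes) (auto simp: t_def cong: bij_betw_cong)
  then have tX: "t permutes X" using YX permutes_subset by blast
  have "{x. t x \<noteq> x} \<subseteq> Y" by (auto simp: t_def)
  then have tfin: "t \<in> finitary_perms X" using tX Y(1) by (auto simp: finitary_perms_def intro: finite_subset)
  \<comment> \<open>The values of an intertwiner are indexed by the source point, those of a group
    element by the target point.\<close>
  let ?\<eta> = "\<lambda>x. \<zeta> (inv_into UNIV t x)"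
  have iY: "inv_into UNIV t x \<in> Y \<longleftrightarrow> x \<in> Y" for x
    by (rule permutes_in_image[OF permutes_inv[OF tY]])
  have sub: "{x. ?\<eta> x \<noteq> \<one>} \<subseteq> Y" using iY by (auto simp: \<zeta>_def)
  have "?\<eta> x \<in> carrier G" for x using th by (simp add: \<zeta>_def)
  then have "?\<eta> \<in> finsupp_funs G X"
    unfolding finsupp_funs_def using subset_trans[OF sub YX] finite_subset[OF sub Y(1)] by blast
  then have h: "(?\<eta>, t) \<in> carrier (W X)" using tfin by (simp add: carrier_wreath)
  have out: "f z = z" "f' z = z" "\<phi> z = \<one>" "\<phi>' z = \<one>" if "z \<notin> Y" for z
    using that by (auto simp: Y_def)
  have fY: "f z \<in> Y \<longleftrightarrow> z \<in> Y" for z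
    using out(1)[of z] imageI[of z Y f] \<open>f ` Y \<subseteq> Y\<close> by (cases "z \<in> Y") auto
  have tf: "t (f z) = f' (t z)" for z
    using t0f[of z] fY[of z] out[of z] by (cases "z \<in> Y") (simp_all add: t_def)
  have key: "\<zeta> (f z) \<otimes> \<phi> (f z) = \<phi>' (t (f z)) \<otimes> \<zeta> z" for z
    using thf[of z] fY[of z] out[of z] by (cases "z \<in> Y") (simp_all add: t_def \<zeta>_def)
  have "?\<eta> x \<otimes> \<phi> (inv_into UNIV t x) = \<phi>' x \<otimes> ?\<eta> (inv_into UNIV f' x)" for x
  proof -
    obtain z where x: "x = t (f z)" 
      using permutes_surj[OF c(3)] permutes_surj[OF tX] by (metis surjD)
    have "inv_into UNIV t x = f z" "inv_into UNIV t (t z) = z"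
      unfolding x by (rule permutes_inverses(2)[OF tX])+
    moreover have "inv_into UNIV f' x = t z"
      unfolding x tf by (rule permutes_inverses(2)[OF c'(3)])
    ultimately show ?thesis using key[of z] x by simp
  qed
  moreover have "t \<circ> f = f' \<circ> t" using tf by auto
  ultimately have "(?\<eta>, t) \<otimes>\<^bsub>W X\<^esub> (\<phi>, f) = (\<phi>', f') \<otimes>\<^bsub>W X\<^esub> (?\<eta>, t)"
    by (simp add: mult_wreath)
  with h show ?thesis by blast
qed

theorem conj_class_wreath_eq_iff:
  assumes "g \<in> carrier (W X)" "g' \<in> carrier (W X)"
  shows "conj_class (W X) g = conj_class (W X) g' \<longleftrightarrow> cycle_type G g = cycle_type G g'"
proof -
  interpret W: group "W X" by (rule group_wreath)
  show ?thesis
    unfolding W.conj_class_eq_iff[OF assms]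
    using assms cycle_type_intertwine cycle_type_eq_imp_intertwine
    by (metis surj_pair)
qed

definition cycle_items :: "(nat \<times> 'a set) set" where
  "cycle_items = ({1..} \<times> conj_classes G) - {(1, {\<one>})}"

lemma cycle_type_decomp:
  assumes "g \<in> carrier (W X)"
  shows "\<exists>B. set_mset B \<subseteq> cycle_items \<and> cycle_type G g = expand B"
proof -
  obtain \<phi> f where g: "g = (\<phi>, f)" by (metis surj_pair)
  note c = wreath_carrierD[OF assms[unfolded g]]
  let ?B = "{x. f x \<noteq> x \<or> \<phi> x \<noteq> \<one>}"
  have "f ` ?B \<subseteq> ?B" by (rule moved_closed[OF c(3)])
  then obtain D where "set_mset D \<subseteq> cycle_data G \<phi> f ` ?B" "cycle_type G g = expand D"
    using cycle_data_decomp[where \<phi> = \<phi>, OF c(2) c(1) c(4)] by (auto simp: g cycle_type_def)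
  moreover have "cycle_data G \<phi> f ` ?B \<subseteq> cycle_items"
  proof (rule image_subsetI)
    fix x assume "x \<in> ?B"
    then have "f x \<noteq> x \<or> \<phi> x \<noteq> \<one>" by simp
    then have "cycle_data G \<phi> f x \<noteq> (1, {\<one>})"
      using cycle_data_trivial_iff[where \<phi> = \<phi>, OF c(2) c(1)] by simp
    moreover have "cycle_data G \<phi> f x \<in> {1..} \<times> conj_classes G"
      using fst_cycle_data[OF c(2), of \<phi> x] c(1) by (auto simp: cycle_data_def conj_classes_def)
    ultimately show "cycle_data G \<phi> f x \<in> cycle_items" by (simp add: cycle_items_def)
  qed
  ultimately show ?thesis by blast
qed

end

section \<open>Lower bound for word length\<close>

lemma word_prod_simps [simp]:
  "word_prod G [] = \<one>\<^bsub>G\<^esub>" "word_prod G (s # w) = s \<otimes>\<^bsub>G\<^esub> word_prod G w"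
  by (simp_all add: word_prod_def)

context group
begin

lemma word_prod_append:
  assumes "set v \<subseteq> carrier G" "set w \<subseteq> carrier G"
  shows "word_prod G v \<in> carrier G" "word_prod G (v @ w) = word_prod G v \<otimes> word_prod G w"
proof -
  have closed: "word_prod G u \<in> carrier G" if "set u \<subseteq> carrier G" for u
    using that by (induction u) auto
  then show "word_prod G v \<in> carrier G" using assms by blast
  show "word_prod G (v @ w) = word_prod G v \<otimes> word_prod G w"
    using assms(1)
  proof (induction v)
    case (Cons s v)
    then show ?case using closed[of v] closed[OF assms(2)] by (simp add: m_assoc)
  qed (use closed[OF assms(2)] in simp)
qed

text \<open>
  Length contributed by a cycle: \<open>k - 1\<close> transpositions, and one point element unless the cycle
  product is trivial. Every positive weight is attained once for each conjugacy class of \<open>H\<close>.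
\<close>

definition item_weight :: "nat \<times> 'a set \<Rightarrow> nat" where
  "item_weight v = fst v - (if snd v = {\<one>} then 1 else 0)"

lemma point_elem_mult: "point_elem G u a \<otimes>\<^bsub>W X\<^esub> (\<psi>, g) = (\<lambda>x. (if x = u then a else \<one>) \<otimes> \<psi> x, g)"
  by (simp add: point_elem_def mult_wreath inv_id fun_eq_iff)

lemma transp_elem_mult: "(\<And>z. \<psi> z \<in> carrier G) \<Longrightarrow> transp_elem G x y \<otimes>\<^bsub>W X\<^esub> (\<psi>, g) =
    (\<lambda>z. \<psi> (Transposition.transpose x y z), Transposition.transpose x y \<circ> g)"
  by (simp add: transp_elem_def mult_wreath)

lemma point_elem_closed: "u \<in> X \<Longrightarrow> a \<in> carrier G \<Longrightarrow> point_elem G u a \<in> carrier (W X)"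
proof -
  assume a: "u \<in> X" "a \<in> carrier G"
  have "{x. ((\<lambda>_. \<one>)(u := a)) x \<noteq> \<one>} \<subseteq> {u}" by auto
  moreover from this have "finite {x. ((\<lambda>_. \<one>)(u := a)) x \<noteq> \<one>}" by (rule finite_subset) simp
  ultimately show "point_elem G u a \<in> carrier (W X)"
    using a by (auto simp: point_elem_def carrier_wreath finsupp_funs_def finitary_perms_def)
qed

lemma transp_elem_closed: "x \<in> X \<Longrightarrow> y \<in> X \<Longrightarrow> transp_elem G x y \<in> carrier (W X)"
  by (simp add: transp_elem_def carrier_wreath finsupp_funs_def transpose_finitary_perms)

definition letters_on :: "'x set \<Rightarrow> (('x \<Rightarrow> 'a) \<times> ('x \<Rightarrow> 'x)) set" where
  "letters_on Y = (\<Union>u\<in>Y. point_elem G u ` carrier G) \<union> (\<Union>x\<in>Y. transp_elem G x ` Y)"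

lemma letters_onE:
  assumes "s \<in> letters_on Y"
  obtains (point) u a where "u \<in> Y" "a \<in> carrier G" "s = point_elem G u a"
  | (transp) x y where "x \<in> Y" "y \<in> Y" "s = transp_elem G x y"
  using assms unfolding letters_on_def by blast

lemma letters_on_mono: "Y \<subseteq> Z \<Longrightarrow> letters_on Y \<subseteq> letters_on Z"
  unfolding letters_on_def by blast

lemma letters_on_carrier: "letters_on X \<subseteq> carrier (W X)"
  by (auto elim!: letters_onE intro: point_elem_closed transp_elem_closed)

text \<open>
  The letters of a word span a graph on \<open>Y\<close>: a transposition is an edge, a point element marks a
  component. The function \<open>r\<close> labels the components and \<open>L\<close> collects the labels of the marked ones;
  every letter either merges two components or marks one.
\<close>

lemma word_component_labels:
  fixes Y :: "'x set"
  assumes "finite Y"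
    and "set w \<subseteq> letters_on Y"
  shows "\<exists>\<phi> f (r :: 'x \<Rightarrow> 'x) L. word_prod (W X) w = (\<phi>, f) \<and> (\<forall>z. \<phi> z \<in> carrier G) \<and>
    {z. f z \<noteq> z \<or> \<phi> z \<noteq> \<one>} \<subseteq> Y \<and> (\<forall>z. r (f z) = r z) \<and> (\<forall>z. \<phi> z \<noteq> \<one> \<longrightarrow> r z \<in> L) \<and>
    L \<subseteq> r ` Y \<and> card Y + card L \<le> length w + card (r ` Y)"
  using assms(2)
proof (induction w)
  case Nil
  \<comment> \<open>For the empty word every point is its own component and none is marked.\<close>
  show ?case
    by (rule exI[of _ "\<lambda>_. \<one>"], rule exI[of _ id], rule exI[of _ id], rule exI[of _ "{}"])
      (simp add: one_wreath id_def)
next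
  case (Cons s w)
  have "\<exists>\<phi> f (r :: 'x \<Rightarrow> 'x) L. word_prod (W X) w = (\<phi>, f) \<and> (\<forall>z. \<phi> z \<in> carrier G) \<and>
    {z. f z \<noteq> z \<or> \<phi> z \<noteq> \<one>} \<subseteq> Y \<and> (\<forall>z. r (f z) = r z) \<and> (\<forall>z. \<phi> z \<noteq> \<one> \<longrightarrow> r z \<in> L) \<and>
    L \<subseteq> r ` Y \<and> card Y + card L \<le> length w + card (r ` Y)"
    using Cons by simp
  then obtain \<phi> f and r :: "'x \<Rightarrow> 'x" and L where w: "word_prod (W X) w = (\<phi>, f)"
    and cl: "\<And>z. \<phi> z \<in> carrier G" and sup: "{z. f z \<noteq> z \<or> \<phi> z \<noteq> \<one>} \<subseteq> Y"
    and r: "\<And>z. r (f z) = r z" "\<And>z. \<phi> z \<noteq> \<one> \<Longrightarrow> r z \<in> L" "L \<subseteq> r ` Y"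
    and card: "card Y + card L \<le> length w + card (r ` Y)"
    by blast
  have finL: "finite L" using r(3) assms(1) finite_subset by blast
  have "s \<in> letters_on Y" using Cons.prems by simp
  then show ?case
  proof (cases rule: letters_onE)
    case (point u a)
    define \<psi> where "\<psi> = (\<lambda>x. (if x = u then a else \<one>) \<otimes> \<phi> x)"
    have "\<psi> z \<noteq> \<one> \<Longrightarrow> z = u \<or> \<phi> z \<noteq> \<one>" for z by (auto simp: \<psi>_def)
    then have \<psi>: "z = u \<or> \<phi> z \<noteq> \<one>" if "\<psi> z \<noteq> \<one>" for z
      using that by simp
    have "z \<in> Y" if "f z \<noteq> z \<or> \<psi> z \<noteq> \<one>" for z
      using that \<psi>[of z] subsetD[OF sup, of z] point(1) by auto
    then have "{z. f z \<noteq> z \<or> \<psi> z \<noteq> \<one>} \<subseteq> Y" by blast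
    moreover have "\<forall>z. \<psi> z \<noteq> \<one> \<longrightarrow> r z \<in> insert (r u) L"
      using \<psi> r(2) by blast
    moreover have "word_prod (W X) (s # w) = (\<psi>, f)"
      by (simp add: w point(3) point_elem_mult \<psi>_def)
    moreover have "\<forall>z. \<psi> z \<in> carrier G" using cl point(2) by (simp add: \<psi>_def)
    moreover have "insert (r u) L \<subseteq> r ` Y" using r(3) point(1) by blast
    moreover have "card Y + card (insert (r u) L) \<le> length (s # w) + card (r ` Y)"
      using card finL by (simp add: card_insert_if)
    ultimately show ?thesis using r(1)
      by - (rule exI[of _ \<psi>], rule exI[of _ f], rule exI[of _ r], rule exI[of _ "insert (r u) L"],
          intro conjI, simp_all)
  next
    case (transp x y)
    let ?t = "Transposition.transpose x y"
    \<comment> \<open>The label of \<open>x\<close> is merged into that of \<open>y\<close>. Only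
      \<open>r x\<close> can disappear, so one letter costs at most one component.\<close>
    define m where "m = (\<lambda>b. if b = r x then r y else b)"
    let ?r = "\<lambda>z. m (r z)"
    have mt: "?r (?t z) = ?r z" for z
      by (cases "z = x"; cases "z = y") (simp_all add: m_def)
    have "?t (f z) \<noteq> z \<or> \<phi> (?t z) \<noteq> \<one> \<Longrightarrow> z \<in> Y" for z
    proof (rule ccontr)
      assume a: "?t (f z) \<noteq> z \<or> \<phi> (?t z) \<noteq> \<one>" and "z \<notin> Y"
      then have "?t z = z" using transp(1,2) by (metis transpose_apply_other)
      moreover have "f z = z" "\<phi> z = \<one>" using sup \<open>z \<notin> Y\<close> by blast+
      ultimately show False using a by simp
    qed
    then have "{z. (?t \<circ> f) z \<noteq> z \<or> \<phi> (?t z) \<noteq> \<one>} \<subseteq> Y" by auto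
    moreover have "word_prod (W X) (s # w) = (\<lambda>z. \<phi> (?t z), ?t \<circ> f)"
      by (simp add: w transp(3) transp_elem_mult cl)
    moreover have "\<forall>z. ?r ((?t \<circ> f) z) = ?r z" by (simp add: mt r(1))
    moreover have "\<forall>z. \<phi> (?t z) \<noteq> \<one> \<longrightarrow> ?r z \<in> m ` L"
    proof (intro allI impI)
      fix z assume "\<phi> (?t z) \<noteq> \<one>"
      then have "?r (?t z) \<in> m ` L" by (intro imageI r(2))
      then show "?r z \<in> m ` L" by (simp only: mt)
    qed
    moreover have "m ` L \<subseteq> ?r ` Y" using r(3) by auto
    moreover have "card Y + card (m ` L) \<le> length (s # w) + card (?r ` Y)"
    proof -
      have "r ` Y \<subseteq> insert (r x) (?r ` Y)"
        by (auto simp: m_def image_iff)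
      then have "card (r ` Y) \<le> card (insert (r x) (?r ` Y))"
        using assms(1) by (intro card_mono) auto
      also have "\<dots> \<le> Suc (card (?r ` Y))"
        using assms(1) by (simp add: card_insert_if)
      finally show ?thesis using card card_image_le[OF finL, of m] by simp
    qed
    ultimately show ?thesis
      by - (rule exI[of _ "\<lambda>z. \<phi> (?t z)"], rule exI[of _ "?t \<circ> f"], rule exI[of _ ?r],
          rule exI[of _ "m ` L"], intro conjI, use cl in \<open>simp_all add: comp_def\<close>)
  qed
qed

lemma cocycle_trivial: "(\<And>i. i < n \<Longrightarrow> \<phi> ((f ^^ Suc i) z) = \<one>) \<Longrightarrow> cocycle G \<phi> f n z = \<one>"
  by (induction n) (simp_all del: funpow.simps)

text \<open>
  Summing the reciprocal of the cycle length over the points of a cycle gives 1, and every unmarked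
  component contains at least one cycle, all of whose cycle products are trivial.
\<close>

lemma component_count_le:
  fixes r :: "'x \<Rightarrow> 'x"
  assumes f: "permutation f" and cl: "\<And>z. \<phi> z \<in> carrier G" and Y: "finite Y" "f ` Y \<subseteq> Y"
    and r: "\<And>z. r (f z) = r z" "\<And>z. \<phi> z \<noteq> \<one> \<Longrightarrow> r z \<in> L" "L \<subseteq> r ` Y"
  shows "real (card (r ` Y)) \<le> card L + (\<Sum>z\<in>Y. if snd (cycle_data G \<phi> f z) = {\<one>}
    then 1 / real (fst (cycle_data G \<phi> f z)) else 0)"
proof -
  let ?h = "\<lambda>z. if snd (cycle_data G \<phi> f z) = {\<one>} then 1 / real (fst (cycle_data G \<phi> f z)) else 0"
  let ?R = "r ` Y - L"
  \<comment> \<open>One point per unmarked component. Labels are constant on orbits, so the orbits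
    of these points are disjoint, and each contributes 1 to the sum.\<close>
  define p where "p = (\<lambda>b. SOME z. z \<in> Y \<and> r z = b)"
  have p: "p b \<in> Y" "r (p b) = b" if "b \<in> ?R" for b
  proof -
    have "\<exists>z. z \<in> Y \<and> r z = b" using that by blast
    then have "p b \<in> Y \<and> r (p b) = b" unfolding p_def by (rule someI_ex)
    then show "p b \<in> Y" "r (p b) = b" by auto
  qed
  have rn: "r ((f ^^ n) z) = r z" for n z by (induction n) (simp_all add: r(1))
  have ro: "r z = r x" if "z \<in> orbit_of f x" for z x
    using that rn unfolding orbit_of_def by blast
  have sub: "orbit_of f (p b) \<subseteq> Y" if "b \<in> ?R" for b
    using orbit_of_subset[OF f Y(2) p(1)[OF that]] .
  have fin: "finite (orbit_of f x)" for x unfolding orbit_of_def by simp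
  have one: "sum ?h (orbit_of f (p b)) = 1" if b: "b \<in> ?R" for b
  proof -
    have "cocycle G \<phi> f n (p b) = \<one>" for n
    proof (rule cocycle_trivial)
      fix n
      have "r ((f ^^ Suc n) (p b)) \<notin> L" unfolding rn p(2)[OF b] using b by blast
      then show "\<phi> ((f ^^ Suc n) (p b)) = \<one>" using r(2) by blast
    qed
    then have "snd (cycle_data G \<phi> f (p b)) = {\<one>}"
      by (simp add: cycle_data_def conj_class_one)
    moreover have "fst (cycle_data G \<phi> f (p b)) = least_power f (p b)"
      by (simp add: cycle_data_def)
    ultimately have "sum ?h (orbit_of f (p b)) = (\<Sum>z\<in>orbit_of f (p b). 1 / real (least_power f (p b)))"
      by (intro sum.cong) (simp_all add: cycle_data_orbit[where \<phi> = \<phi>, OF f cl])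
    also have "\<dots> = 1"
      using card_orbit_of[OF f, of "p b"] least_power_of_permutation(2)[OF f, of "p b"] by simp
    finally show ?thesis .
  qed
  have "real (card (r ` Y)) \<le> card L + real (card ?R)"
  proof -
    have "finite L" using r(3) Y(1) finite_subset by blast
    then show ?thesis using card_Diff_subset[of L "r ` Y"] r(3) Y(1) by simp
  qed
  also have "real (card ?R) = (\<Sum>b\<in>?R. sum ?h (orbit_of f (p b)))"
    using one by simp
  also have "\<dots> = sum ?h (\<Union>b\<in>?R. orbit_of f (p b))"
  proof (rule sum.UNION_disjoint[symmetric])
    show "\<forall>b\<in>?R. \<forall>c\<in>?R. b \<noteq> c \<longrightarrow> orbit_of f (p b) \<inter> orbit_of f (p c) = {}"
      using ro p(2) by (metis (no_types, lifting) disjoint_iff)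
  qed (use Y fin in auto)
  also have "\<dots> \<le> sum ?h Y"
    using sub Y(1) by (intro sum_mono2) auto
  finally show ?thesis by simp
qed

lemma cycle_itemsD:
  assumes "v \<in> cycle_items"
  shows "fst v \<ge> 1" "item_weight v \<ge> 1"
proof -
  obtain k c where v: "v = (k, c)" by (cases v)
  have kc: "k \<ge> 1" "(k, c) \<noteq> (1, {\<one>})"
    using assms unfolding cycle_items_def v by simp_all
  then show "fst v \<ge> 1" by (simp add: v)
  show "item_weight v \<ge> 1"
    using kc by (cases "c = {\<one>}") (simp_all add: v item_weight_def)
qed

text \<open>Each point of a cycle of length \<open>k\<close> contributes \<open>1\<close>, less
  \<open>1 / k\<close> if the product is trivial, so the whole cycle contributes its weight. Trivial
  points of \<open>Y\<close> contribute 0, and the total subtracted is what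
  \<open>component_count_le\<close> bounds from below.\<close>

lemma sum_item_weight_le:
  fixes r :: "'x \<Rightarrow> 'x"
  assumes f: "permutation f" and cl: "\<And>z. \<phi> z \<in> carrier G" and Y: "finite Y" "f ` Y \<subseteq> Y"
    and r: "\<And>z. r (f z) = r z" "\<And>z. \<phi> z \<noteq> \<one> \<Longrightarrow> r z \<in> L" "L \<subseteq> r ` Y"
    and sup: "{z. f z \<noteq> z \<or> \<phi> z \<noteq> \<one>} \<subseteq> Y"
    and B: "set_mset B \<subseteq> cycle_items" "cycle_type G (\<phi>, f) = expand B"
  shows "(\<Sum>v\<in>#B. item_weight v) + card (r ` Y) \<le> card Y + card L"
proof -
  let ?h = "\<lambda>v :: nat \<times> 'a set. if snd v = {\<one>} then 1 / real (fst v) else 0"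
  let ?d = "cycle_data G \<phi> f"
  have "real (\<Sum>v\<in>#B. item_weight v) = (\<Sum>v\<in>#expand B. 1 - ?h v)"
    using B(1)
  proof (induction B)
    case (add v B)
    then have "fst v \<ge> 1" using cycle_itemsD(1)[of v] by auto
    then have "real (item_weight v) = real (fst v) * (1 - ?h v)"
      by (auto simp: item_weight_def field_simps of_nat_diff)
    then show ?case using add by simp
  qed simp
  also have "\<dots> = (\<Sum>v\<in>#image_mset ?d (mset_set Y). 1 - ?h v)"
    unfolding image_cycle_data_superset[where \<phi> = \<phi>, OF f cl Y(1) sup] B(2) by simp
  also have "\<dots> = (\<Sum>z\<in>Y. 1 - ?h (?d z))"
    by (simp add: multiset.map_comp comp_def flip: sum_unfold_sum_mset)
  also have "\<dots> = card Y - (\<Sum>z\<in>Y. ?h (?d z))"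
    by (simp add: sum_subtractf)
  finally show ?thesis
    using component_count_le[where \<phi> = \<phi> and r = r, OF f cl Y r] by linarith
qed

lemma finite_vertices_of_word:
  assumes "set w \<subseteq> letters_on X"
  shows "\<exists>Y. finite Y \<and> set w \<subseteq> letters_on Y"
  using assms
proof (induction w)
  case Nil
  show ?case by (intro exI[of _ "{}"]) simp
next
  case (Cons s w)
  then obtain Y where Y: "finite Y" "set w \<subseteq> letters_on Y" by auto
  have "s \<in> letters_on X" using Cons.prems by simp
  then obtain U where U: "finite U" "s \<in> letters_on U"
  proof (cases rule: letters_onE)
    case (point u a)
    then show thesis by (intro that[of "{u}"]) (auto simp: letters_on_def)
  next
    case (transp x y)
    then show thesis by (intro that[of "{x, y}"]) (auto simp: letters_on_def)
  qed
  have "s \<in> letters_on (Y \<union> U)" "set w \<subseteq> letters_on (Y \<union> U)"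
    using Y(2) U(2) letters_on_mono[of Y "Y \<union> U"] letters_on_mono[of U "Y \<union> U"] by blast+
  with Y(1) U(1) show ?case by (intro exI[of _ "Y \<union> U"]) simp
qed

text \<open>Weight plus components is at most points plus marked labels, which is at most letters
  plus components; the components cancel.\<close>

theorem sum_item_weight_le_length:
  fixes X :: "'x set"
  assumes w: "set w \<subseteq> letters_on X"
    and B: "set_mset B \<subseteq> cycle_items" "cycle_type G (word_prod (W X) w) = expand B"
  shows "(\<Sum>v\<in>#B. item_weight v) \<le> length w"
proof -
  obtain Y where Y: "finite Y" "set w \<subseteq> letters_on Y"
    using finite_vertices_of_word[OF w] by blast
  obtain \<phi> f and r :: "'x \<Rightarrow> 'x" and L where wp: "word_prod (W X) w = (\<phi>, f)"
    and cl: "\<And>z. \<phi> z \<in> carrier G" and sup: "{z. f z \<noteq> z \<or> \<phi> z \<noteq> \<one>} \<subseteq> Y"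
    and r: "\<And>z. r (f z) = r z" "\<And>z. \<phi> z \<noteq> \<one> \<Longrightarrow> r z \<in> L" "L \<subseteq> r ` Y"
    and card: "card Y + card L \<le> length w + card (r ` Y)"
    using word_component_labels[OF Y, where X = X] by blast
  interpret W: group "W X" by (rule group_wreath)
  have "set w \<subseteq> carrier (W X)"
    using w letters_on_carrier by blast
  then have g: "(\<phi>, f) \<in> carrier (W X)" using W.word_prod_append(1)[of w "[]"] wp by simp
  note c = wreath_carrierD[OF g]
  have fY: "f ` Y \<subseteq> Y"
  proof (rule image_subsetI)
    fix z assume "z \<in> Y"
    show "f z \<in> Y"
    proof (cases "f z = z")
      case False
      then have "f (f z) \<noteq> f z" using permutes_inj[OF c(3)] by (auto dest: injD)
      then show ?thesis using sup by blast
    qed (use \<open>z \<in> Y\<close> in simp)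
  qed
  show ?thesis
    using sum_item_weight_le[where \<phi> = \<phi> and r = r, OF c(2) cl Y(1) fY r sup B(1)] B(2) card
    by (simp add: wp)
qed

end

section \<open>Cycles from trees\<close>

text \<open>Otherwise no path starting at \<open>x\<close> could leave \<open>U\<close>.\<close>

lemma graph_connected_boundary_edge:
  assumes "graph_connected V E" "x \<in> U" "U \<subseteq> V" "y \<in> V" "y \<notin> U"
  shows "\<exists>u v. u \<in> U \<and> v \<notin> U \<and> {u, v} \<in> E"
proof (rule ccontr)
  assume no: "\<not> ?thesis"
  have "(x, y) \<in> {(u, v). {u, v} \<in> E}\<^sup>*"
    using assms unfolding graph_connected_def by blast
  then have "y \<in> U"
  proof (induction rule: rtrancl_induct)
    case base show ?case by (rule assms(2))
  next
    case (step y z)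
    then show ?case using no by blast
  qed
  then show False using assms(5) by simp
qed

text \<open>
  Left multiplication by a transposition joining the support of a cycle to a new point inserts that
  point into the cycle.
\<close>

lemma cycle_insert_point:
  assumes \<sigma>: "\<sigma> permutes U" "u \<in> U" "v \<notin> U" "x \<in> U"
    and reach: "\<And>y. y \<in> U \<Longrightarrow> \<exists>i. (\<sigma> ^^ i) x = y"
    and y: "y \<in> insert v U"
  shows "\<exists>i. ((Transposition.transpose u v \<circ> \<sigma>) ^^ i) x = y"
proof -
  let ?\<tau> = "Transposition.transpose u v \<circ> \<sigma>"
  have inU: "(\<sigma> ^^ i) x \<in> U" for i
    by (induction i) (use \<sigma> permutes_in_image[OF \<sigma>(1)] in auto)
  have \<tau>v: "?\<tau> v = u" using permutes_not_in[OF \<sigma>(1,3)] by simp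
  have \<tau>u: "?\<tau> z = v" if "\<sigma> z = u" for z using that by simp
  have \<tau>z: "?\<tau> z = \<sigma> z" if "z \<in> U" "\<sigma> z \<noteq> u" for z
  proof -
    have "\<sigma> z \<noteq> v" using that(1) \<sigma>(3) permutes_in_image[OF \<sigma>(1), of z] by auto
    then show ?thesis using that(2) by simp
  qed
  \<comment> \<open>The new permutation follows \<open>\<sigma>\<close>, except that where
    \<open>\<sigma>\<close> enters \<open>u\<close> it visits \<open>v\<close> first and reaches
    \<open>u\<close> one step later.\<close>
  have re: "\<exists>j. (?\<tau> ^^ j) x = (\<sigma> ^^ i) x" for i
  proof (induction i)
    case 0
    show ?case by (rule exI[of _ 0]) simp
  next
    case (Suc i)
    then obtain j where j: "(?\<tau> ^^ j) x = (\<sigma> ^^ i) x" by blast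
    show ?case
    proof (cases "\<sigma> ((\<sigma> ^^ i) x) = u")
      case True
      have "(?\<tau> ^^ Suc (Suc j)) x = ?\<tau> (?\<tau> ((\<sigma> ^^ i) x))"
        by (simp only: funpow.simps comp_apply[of ?\<tau>] j)
      also have "\<dots> = (\<sigma> ^^ Suc i) x" unfolding \<tau>u[OF True] \<tau>v using True by simp
      finally show ?thesis by blast
    next
      case False
      have "(?\<tau> ^^ Suc j) x = ?\<tau> ((\<sigma> ^^ i) x)"
        by (simp only: funpow.simps comp_apply[of ?\<tau>] j)
      also have "\<dots> = (\<sigma> ^^ Suc i) x" unfolding \<tau>z[OF inU False] by simp
      finally show ?thesis by blast
    qed
  qed
  show ?thesis
  proof (cases "y = v")
    case True
    obtain p where p: "\<sigma> p = u" using permutes_surj[OF \<sigma>(1)] by (metis surjD)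
    then have "p \<in> U" using permutes_in_image[OF \<sigma>(1), of p] \<sigma>(2) by simp
    then obtain i where "(\<sigma> ^^ i) x = p" using reach by blast
    then obtain j where "(?\<tau> ^^ j) x = p" using re[of i] by auto
    then have "(?\<tau> ^^ Suc j) x = ?\<tau> p" by (simp only: funpow.simps comp_apply[of ?\<tau>])
    then show ?thesis unfolding \<tau>u[OF p] True by blast
  next
    case False
    then obtain i where "(\<sigma> ^^ i) x = y" using y reach by blast
    then show ?thesis using re[of i] by simp
  qed
qed

context group
begin

lemma transp_elem_commute: "transp_elem G x y = transp_elem G y x"
  by (simp add: transp_elem_def transpose_commute)

text \<open>The cycle grows by one boundary edge at a time, which connectedness supplies as long as
  \<open>U \<noteq> V\<close>. For \<open>n = card V - 1\<close> it covers all of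
  \<open>V\<close>.\<close>

lemma connected_cycle_word:
  assumes V: "x \<in> V" "graph_connected V E"
    and E: "E \<subseteq> {{u, v} |u v. u \<in> V \<and> v \<in> V \<and> u \<noteq> v}" "E \<subseteq> transp_graph_edges G X S"
    and n: "n < card V"
  shows "\<exists>U w \<sigma>. x \<in> U \<and> U \<subseteq> V \<and> card U = Suc n \<and> set w \<subseteq> S \<and> length w = n \<and>
    word_prod (W X) w = (\<lambda>_. \<one>, \<sigma>) \<and> \<sigma> permutes U \<and> (\<forall>y\<in>U. \<exists>i. (\<sigma> ^^ i) x = y)"
  using n
proof (induction n)
  case 0
  show ?case
    by (rule exI[of _ "{x}"], rule exI[of _ "[]"], rule exI[of _ id])
      (use V in \<open>auto simp: one_wreath permutes_id intro: exI[of _ 0]\<close>)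
next
  case (Suc n)
  then obtain U w \<sigma> where U: "x \<in> U" "U \<subseteq> V" "card U = Suc n" and w: "set w \<subseteq> S" "length w = n"
    "word_prod (W X) w = (\<lambda>_. \<one>, \<sigma>)" and \<sigma>: "\<sigma> permutes U" "\<And>y. y \<in> U \<Longrightarrow> \<exists>i. (\<sigma> ^^ i) x = y"
    by (metis Suc_lessD)
  have "U \<noteq> V" using U(3) Suc.prems by auto
  then obtain y where "y \<in> V" "y \<notin> U" using U(2) by blast
  then obtain u v where uv: "u \<in> U" "v \<notin> U" "{u, v} \<in> E"
    using graph_connected_boundary_edge[OF V(2) U(1,2)] by blast
  have vV: "v \<in> V" using subsetD[OF E(1) uv(3)] by (auto simp: doubleton_eq_iff)
  obtain a b where ab: "{u, v} = {a, b}" "transp_elem G a b \<in> S"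
    using E(2) uv(3) unfolding transp_graph_edges_def by blast
  then have uvS: "transp_elem G u v \<in> S"
    using transp_elem_commute[of a b] by (auto simp: doubleton_eq_iff)
  define \<tau> where "\<tau> = Transposition.transpose u v \<circ> \<sigma>"
  have "word_prod (W X) (transp_elem G u v # w) = (\<lambda>_. \<one>, \<tau>)"
    by (simp add: w(3) transp_elem_mult \<tau>_def)
  moreover have "\<tau> permutes insert v U"
    using uv(1) permutes_subset[OF \<sigma>(1), of "insert v U"]
    unfolding \<tau>_def by (intro permutes_compose permutes_swap_id) auto
  moreover have "\<forall>y\<in>insert v U. \<exists>i. (\<tau> ^^ i) x = y"
    using cycle_insert_point[OF \<sigma>(1) uv(1,2) U(1) \<sigma>(2)] unfolding \<tau>_def by blast
  moreover have "card (insert v U) = Suc (Suc n)"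
    using U(3) uv(2) card_ge_0_finite[of U] by simp
  ultimately show ?case
    using U vV w uvS
    by - (rule exI[of _ "insert v U"], rule exI[of _ "transp_elem G u v # w"], rule exI[of _ \<tau>], simp)
qed

text \<open>The edges give a cycle on \<open>V\<close> with trivial product in
  \<open>fst v - 1\<close> letters; one point element at \<open>x\<close> then sets the product to a
  representative \<open>a\<close> of the class. It is omitted when \<open>a = \<one>\<close>, which
  is the saving in \<open>item_weight\<close>.\<close>

lemma cycle_item_word:
  assumes v: "v \<in> cycle_items"
    and V: "x \<in> V" "graph_connected V E" "card V = fst v" "V \<subseteq> X"
    and E: "E \<subseteq> {{u, v} |u v. u \<in> V \<and> v \<in> V \<and> u \<noteq> v}" "E \<subseteq> transp_graph_edges G X T"
    and P: "\<And>a. a \<in> carrier G - {\<one>} \<Longrightarrow> point_elem G x a \<in> P"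
  shows "\<exists>w \<phi> f. set w \<subseteq> P \<union> T \<and> length w = item_weight v \<and> word_prod (W X) w = (\<phi>, f) \<and>
    (\<phi>, f) \<in> carrier (W X) \<and> {z. f z \<noteq> z \<or> \<phi> z \<noteq> \<one>} \<subseteq> V \<and>
    cycle_type G (\<phi>, f) = replicate_mset (fst v) v"
proof -
  obtain a where a: "a \<in> carrier G" "snd v = conj_class G a"
  proof -
    have "v \<in> {1..} \<times> conj_classes G" using v unfolding cycle_items_def by (rule DiffD1)
    then show thesis using that unfolding conj_classes_def by (auto simp: mem_Times_iff)
  qed
  have k: "fst v \<ge> 1" using cycle_itemsD(1)[OF v] .
  then have finV: "finite V" using V(3) card_ge_0_finite[of V] by simp
  obtain U w f where U: "U \<subseteq> V" "card U = Suc (fst v - 1)" and w: "set w \<subseteq> T" "length w = fst v - 1"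
    "word_prod (W X) w = (\<lambda>_. \<one>, f)" and f': "f permutes U" "\<forall>y\<in>U. \<exists>i. (f ^^ i) x = y"
    using connected_cycle_word[OF V(1,2) E, of "fst v - 1"] k V(3) by auto
  have "U = V" using U k V(3) finV by (intro card_subset_eq) auto
  then have f: "f permutes V" "\<And>y. y \<in> V \<Longrightarrow> \<exists>i. (f ^^ i) x = y" using f' by auto
  have perm: "permutation f" using f(1) finV by (metis permutation_permutes)
  define \<phi> where "\<phi> = (\<lambda>z. if z = x then a else \<one>)"
  define w' where "w' = (if a = \<one> then w else point_elem G x a # w)"
  have cl: "\<phi> z \<in> carrier G" for z using a(1) by (simp add: \<phi>_def)
  have w': "set w' \<subseteq> P \<union> T" "length w' = item_weight v" "word_prod (W X) w' = (\<phi>, f)"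
  proof -
    show "set w' \<subseteq> P \<union> T" using w(1) P[of a] a(1) by (auto simp: w'_def)
    show "length w' = item_weight v"
      using w(2) k conj_class_eq_one_iff[OF a(1)] by (simp add: w'_def item_weight_def a(2))
    have "(\<lambda>z. (if z = x then a else \<one>) \<otimes> \<one>) = \<phi>" using a(1) by (auto simp: \<phi>_def)
    then show "word_prod (W X) w' = (\<phi>, f)"
      by (auto simp: w'_def w(3) point_elem_mult \<phi>_def)
  qed
  have sup: "{z. f z \<noteq> z \<or> \<phi> z \<noteq> \<one>} \<subseteq> V"
    using permutes_not_in[OF f(1)] V(1) by (auto simp: \<phi>_def split: if_splits)
  have car: "(\<phi>, f) \<in> carrier (W X)"
  proof -
    have "{z. f z \<noteq> z} \<subseteq> V" "{z. \<phi> z \<noteq> \<one>} \<subseteq> V" using sup by auto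
    then show ?thesis
      unfolding carrier_wreath finsupp_funs_def finitary_perms_def
      using V(4) finV cl permutes_subset[OF f(1) V(4)]
      by (simp add: finite_subset[of _ V] subset_trans[of _ V X])
  qed
  have "orbit_of f x = V"
  proof
    show "orbit_of f x \<subseteq> V"
      using f(1) V(1) by (intro orbit_of_subset[OF perm]) (simp_all add: permutes_image)
    show "V \<subseteq> orbit_of f x"
      unfolding orbit_of_eq_range[OF perm] using f(2) by blast
  qed
  then have orb: "least_power f x = fst v" "\<And>z. z \<in> V \<Longrightarrow> z \<in> orbit_of f x"
    using card_orbit_of[OF perm, of x] V(3) by simp_all
  obtain m where m: "fst v = Suc m" using k by (cases "fst v") auto
  \<comment> \<open>The only nontrivial value of \<open>\<phi>\<close> sits at \<open>x\<close>,
    which the iterates reach again only at the last step.\<close>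
  have "cocycle G \<phi> f m x = \<one>"
  proof (rule cocycle_trivial)
    fix i assume "i < m"
    then have "(f ^^ Suc i) x \<noteq> x"
      using least_power_le[of "Suc i" f x] orb(1) m by auto
    then show "\<phi> ((f ^^ Suc i) x) = \<one>" by (simp add: \<phi>_def)
  qed
  moreover have "(f ^^ Suc m) x = x"
    using least_power_of_permutation(1)[OF perm, of x] orb(1) m by simp
  ultimately have "cocycle G \<phi> f (fst v) x = a"
    unfolding m cocycle.simps using a(1) by (simp add: \<phi>_def del: funpow.simps)
  then have "cycle_data G \<phi> f x = v"
    using a(2) orb(1) by (simp add: cycle_data_def prod_eq_iff)
  then have d: "cycle_data G \<phi> f z = v" if "z \<in> V" for z
    using cycle_data_orbit[where \<phi> = \<phi>, OF perm cl orb(2)[OF that]] by simp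
  have "v \<noteq> (1, {\<one>})" using v by (auto simp: cycle_items_def)
  then have "V \<subseteq> {z. f z \<noteq> z \<or> \<phi> z \<noteq> \<one>}"
    using d cycle_data_trivial_iff[where \<phi> = \<phi>, OF perm cl] by fastforce
  then have supV: "{z. f z \<noteq> z \<or> \<phi> z \<noteq> \<one>} = V" using sup by blast
  have "cycle_type G (\<phi>, f) = image_mset (\<lambda>_. v) (mset_set V)"
    unfolding cycle_type_def prod.case supV using d finV by (intro image_mset_cong) simp
  then have "cycle_type G (\<phi>, f) = replicate_mset (fst v) v"
    using V(3) by (simp add: image_mset_const_eq)
  with w' car sup show ?thesis by blast
qed

text \<open>Each support is invariant under its own permutation, so the product agrees with the
  first factor on \<open>A1\<close> and with the second factor elsewhere.\<close>

lemma cycle_type_mult_disjoint: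
  assumes g: "(\<phi>1, f1) \<in> carrier (W X)" and h: "(\<phi>2, f2) \<in> carrier (W X)"
    and disj: "{z. f1 z \<noteq> z \<or> \<phi>1 z \<noteq> \<one>} \<inter> {z. f2 z \<noteq> z \<or> \<phi>2 z \<noteq> \<one>} = {}"
    and eq: "(\<phi>1, f1) \<otimes>\<^bsub>W X\<^esub> (\<phi>2, f2) = (\<phi>, f)"
  shows "{z. f z \<noteq> z \<or> \<phi> z \<noteq> \<one>} = {z. f1 z \<noteq> z \<or> \<phi>1 z \<noteq> \<one>} \<union> {z. f2 z \<noteq> z \<or> \<phi>2 z \<noteq> \<one>}"
    and "cycle_type G (\<phi>, f) = cycle_type G (\<phi>1, f1) + cycle_type G (\<phi>2, f2)"
proof -
  note c1 = wreath_carrierD[OF g] and c2 = wreath_carrierD[OF h]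
  have car: "(\<phi>, f) \<in> carrier (W X)" using wreath_mult_closed[OF g h] eq by simp
  note c = wreath_carrierD[OF car]
  define A1 where "A1 = {z. f1 z \<noteq> z \<or> \<phi>1 z \<noteq> \<one>}"
  define A2 where "A2 = {z. f2 z \<noteq> z \<or> \<phi>2 z \<noteq> \<one>}"
  have A: "A1 \<inter> A2 = {}" using disj by (simp only: A1_def A2_def)
  have cA: "f1 ` A1 \<subseteq> A1" "f2 ` A2 \<subseteq> A2"
    unfolding A1_def A2_def by (rule moved_closed[OF c1(3)], rule moved_closed[OF c2(3)])
  have fin: "finite A1" "finite A2" using c1(4) c2(4) by (simp_all only: A1_def A2_def)
  have out1: "f1 z = z" "\<phi>1 z = \<one>" if "z \<notin> A1" for z using that by (auto simp: A1_def)
  have out2: "f2 z = z" "\<phi>2 z = \<one>" if "z \<notin> A2" for z using that by (auto simp: A2_def)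
  have \<phi>: "\<phi> z = \<phi>1 z \<otimes> \<phi>2 (inv_into UNIV f1 z)" and f: "f z = f1 (f2 z)" for z
    using eq by (auto simp: mult_wreath)
  have on1: "f z = f1 z" "\<phi> z = \<phi>1 z" if z: "z \<in> A1" for z
  proof -
    have "z \<notin> A2" using A z by blast
    then show "f z = f1 z" by (simp add: f out2(1))
    have "f1 (inv_into UNIV f1 z) = z" using permutes_inverses(1)[OF c1(3)] .
    then have "inv_into UNIV f1 z \<in> A1" using out1(1)[of "inv_into UNIV f1 z"] z by (cases "inv_into UNIV f1 z \<in> A1") auto
    then have "\<phi>2 (inv_into UNIV f1 z) = \<one>" using A out2(2) by blast
    then show "\<phi> z = \<phi>1 z" using c1(1) by (simp add: \<phi>)
  qed
  have on2: "f z = f2 z" "\<phi> z = \<phi>2 z" if z: "z \<notin> A1" for z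
  proof -
    have "f2 z \<notin> A1" using cA(2) out2(1)[of z] A z by (cases "z \<in> A2") auto
    then show "f z = f2 z" by (simp add: f out1)
    have "inv_into UNIV f1 z = z" using out1(1)[OF z] permutes_inverses(2)[OF c1(3), of z] by simp
    then show "\<phi> z = \<phi>2 z" using c2(1) by (simp add: \<phi> out1(2)[OF z])
  qed
  have sup: "{z. f z \<noteq> z \<or> \<phi> z \<noteq> \<one>} = A1 \<union> A2"
  proof -
    have "f z \<noteq> z \<or> \<phi> z \<noteq> \<one> \<longleftrightarrow> z \<in> A1 \<union> A2" for z
    proof (cases "z \<in> A1")
      case True
      then show ?thesis using on1[OF True] by (simp add: A1_def)
    next
      case False
      then show ?thesis using on2[OF False] by (simp add: A2_def)
    qed
    then show ?thesis by blast
  qed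
  then show "{z. f z \<noteq> z \<or> \<phi> z \<noteq> \<one>} = {z. f1 z \<noteq> z \<or> \<phi>1 z \<noteq> \<one>} \<union> {z. f2 z \<noteq> z \<or> \<phi>2 z \<noteq> \<one>}"
    by (simp only: A1_def A2_def)
  have "cycle_data G \<phi> f z = cycle_data G \<phi>1 f1 z" if "z \<in> A1" for z
    by (rule cycle_data_cong[OF c1(2) cA(1) that]) (use on1 c1(1) c(1) in auto)
  moreover have "cycle_data G \<phi> f z = cycle_data G \<phi>2 f2 z" if "z \<in> A2" for z
    by (rule cycle_data_cong[OF c2(2) cA(2) that]) (use on2 A c2(1) c(1) in auto)
  ultimately have "image_mset (cycle_data G \<phi> f) (mset_set A1) = image_mset (cycle_data G \<phi>1 f1) (mset_set A1)"
    "image_mset (cycle_data G \<phi> f) (mset_set A2) = image_mset (cycle_data G \<phi>2 f2) (mset_set A2)"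
    using fin by (auto intro!: image_mset_cong)
  then show "cycle_type G (\<phi>, f) = cycle_type G (\<phi>1, f1) + cycle_type G (\<phi>2, f2)"
    unfolding cycle_type_def prod.case sup
    by (simp only: mset_set_Union[OF fin A] image_mset_union A1_def[symmetric] A2_def[symmetric])
qed

text \<open>The cycle lengths form a partition, for which PCwr provides disjoint trees. The words
  built on them have disjoint supports, so concatenation adds both lengths and cycle types.\<close>

theorem PCwr_realizes_cycle_type:
  fixes P T :: "(('x \<Rightarrow> 'a) \<times> ('x \<Rightarrow> 'x)) set"
  assumes PC: "PCwr G X P T" and B: "set_mset B \<subseteq> cycle_items"
  shows "\<exists>w. set w \<subseteq> P \<union> T \<and> length w = (\<Sum>v\<in>#B. item_weight v) \<and>
    word_prod (W X) w \<in> carrier (W X) \<and> cycle_type G (word_prod (W X) w) = expand B"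
proof -
  interpret W: group "W X" by (rule group_wreath)
  obtain xs where xs: "mset xs = B" using ex_mset by blast
  \<comment> \<open>Partitions are weakly decreasing, whereas \<open>sort_key\<close> sorts
    upwards.\<close>
  define vs where "vs = rev (sort_key fst xs)"
  have vs: "mset vs = B" by (simp add: vs_def xs)
  have item: "vs ! i \<in> cycle_items" if "i < length vs" for i
    using that B vs by (metis nth_mem set_mset_mset subsetD)
  have "sorted_wrt (\<ge>) (map fst vs)"
    unfolding vs_def rev_map[symmetric] sorted_wrt_rev using sorted_sort_key[of fst xs] by simp
  moreover have "l \<ge> 1" if l: "l \<in> set (map fst vs)" for l
  proof -
    obtain v where "v \<in> set vs" "l = fst v" using l by auto
    then obtain i where "i < length vs" "l = fst (vs ! i)" by (auto simp: in_set_conv_nth)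
    then show ?thesis using cycle_itemsD(1)[OF item] by simp
  qed
  ultimately have "is_partition (map fst vs) (sum_list (map fst vs))"
    by (simp add: is_partition_def)
  then have "\<exists>V E x. disjoint_family_on V {..<length (map fst vs)} \<and>
           (\<forall>i<length (map fst vs).
              is_tree (V i) (E i) \<and> V i \<subseteq> X \<and> E i \<subseteq> transp_graph_edges G X T \<and>
              card (V i) = map fst vs ! i \<and> x i \<in> V i \<and>
              (\<forall>a \<in> carrier G - {\<one>}. point_elem G (x i) a \<in> P))"
    using PC unfolding PCwr_def by blast
  then obtain V E x where disj: "disjoint_family_on V {..<length vs}"
    and tree: "\<And>i. i < length vs \<Longrightarrow> is_tree (V i) (E i) \<and> V i \<subseteq> X \<and> E i \<subseteq> transp_graph_edges G X T \<and>
              card (V i) = map fst vs ! i \<and> x i \<in> V i \<and>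
              (\<forall>a \<in> carrier G - {\<one>}. point_elem G (x i) a \<in> P)"
    unfolding length_map by blast
  have sub: "P \<union> T \<subseteq> carrier (W X)"
    using PC unfolding PCwr_def point_elems_def transp_elems_def
    by (blast intro: point_elem_closed transp_elem_closed)
  have "\<exists>w \<phi> f. set w \<subseteq> P \<union> T \<and> length w = (\<Sum>v\<leftarrow>take n vs. item_weight v) \<and>
    word_prod (W X) w = (\<phi>, f) \<and> (\<phi>, f) \<in> carrier (W X) \<and>
    {z. f z \<noteq> z \<or> \<phi> z \<noteq> \<one>} \<subseteq> (\<Union>i<n. V i) \<and> cycle_type G (\<phi>, f) = expand (mset (take n vs))"
    if "n \<le> length vs" for n
    using that
  proof (induction n)
    case 0
    have "cycle_type G (\<lambda>_. \<one>, id) = {#}" by (simp add: cycle_type_def)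
    then show ?case
      using W.one_closed
      by - (rule exI[of _ "[]"], rule exI[of _ "\<lambda>_. \<one>"], rule exI[of _ id], simp add: one_wreath id_def)
  next
    case (Suc n)
    then obtain w \<phi> f where w: "set w \<subseteq> P \<union> T" "length w = (\<Sum>v\<leftarrow>take n vs. item_weight v)"
      "word_prod (W X) w = (\<phi>, f)" and g: "(\<phi>, f) \<in> carrier (W X)"
      and sup: "{z. f z \<noteq> z \<or> \<phi> z \<noteq> \<one>} \<subseteq> (\<Union>i<n. V i)"
      and ct: "cycle_type G (\<phi>, f) = expand (mset (take n vs))"
      using Suc_leD by blast
    have n: "n < length vs" using Suc.prems by simp
    note tr = tree[OF n]
    have E1: "E n \<subseteq> {{u, v} |u v. u \<in> V n \<and> v \<in> V n \<and> u \<noteq> v}" "graph_connected (V n) (E n)"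
      using tr unfolding is_tree_def by blast+
    have cV: "card (V n) = fst (vs ! n)" using tr n by simp
    obtain w2 \<phi>2 f2 where w2: "set w2 \<subseteq> P \<union> T" "length w2 = item_weight (vs ! n)"
      "word_prod (W X) w2 = (\<phi>2, f2)" and g2: "(\<phi>2, f2) \<in> carrier (W X)"
      and sup2: "{z. f2 z \<noteq> z \<or> \<phi>2 z \<noteq> \<one>} \<subseteq> V n"
      and ct2: "cycle_type G (\<phi>2, f2) = replicate_mset (fst (vs ! n)) (vs ! n)"
      using cycle_item_word[OF item[OF n], where x = "x n" and V = "V n" and E = "E n" and X = X and T = T and P = P]
        tr E1 cV by blast
    obtain \<psi> h where gh: "(\<phi>2, f2) \<otimes>\<^bsub>W X\<^esub> (\<phi>, f) = (\<psi>, h)" by (metis surj_pair)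
    have "V n \<inter> (\<Union>i<n. V i) = {}"
    proof -
      have "V n \<inter> V i = {}" if "i < n" for i
        using disjoint_family_onD[OF disj, of n i] that n by simp
      then show ?thesis by blast
    qed
    then have dis: "{z. f2 z \<noteq> z \<or> \<phi>2 z \<noteq> \<one>} \<inter> {z. f z \<noteq> z \<or> \<phi> z \<noteq> \<one>} = {}"
      using sup sup2 by blast
    note md = cycle_type_mult_disjoint[OF g2 g dis gh]
    have tk: "take (Suc n) vs = take n vs @ [vs ! n]" using n by (rule take_Suc_conv_app_nth)
    have "word_prod (W X) (w2 @ w) = (\<psi>, h)"
      using W.word_prod_append(2)[of w2 w] w w2 sub gh by auto
    moreover have "(\<psi>, h) \<in> carrier (W X)" using W.m_closed[OF g2 g] gh by simp
    moreover have "{z. h z \<noteq> z \<or> \<psi> z \<noteq> \<one>} \<subseteq> (\<Union>i<Suc n. V i)"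
      unfolding md(1) lessThan_Suc using sup sup2 by blast
    moreover have "cycle_type G (\<psi>, h) = expand (mset (take (Suc n) vs))"
      unfolding md(2) tk by (simp add: ct ct2)
    moreover have "length (w2 @ w) = (\<Sum>v\<leftarrow>take (Suc n) vs. item_weight v)"
      unfolding tk by (simp add: w(2) w2(2))
    moreover have "set (w2 @ w) \<subseteq> P \<union> T" using w(1) w2(1) by simp
    ultimately show ?case
      by - (rule exI[of _ "w2 @ w"], rule exI[of _ \<psi>], rule exI[of _ h], intro conjI)
  qed
  from this[of "length vs"] obtain w \<phi> f where "set w \<subseteq> P \<union> T" "length w = (\<Sum>v\<leftarrow>vs. item_weight v)"
    "word_prod (W X) w = (\<phi>, f)" "(\<phi>, f) \<in> carrier (W X)" "cycle_type G (\<phi>, f) = expand (mset vs)"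
    by auto
  moreover have "(\<Sum>v\<leftarrow>vs. item_weight v) = (\<Sum>v\<in>#B. item_weight v)"
    unfolding vs[symmetric] by (simp flip: sum_mset_sum_list)
  ultimately show ?thesis unfolding vs by metis
qed

end

section \<open>Conjugacy growth\<close>

context group
begin

lemma cycle_type_conj_class:
  assumes "g \<in> carrier (W X)" "h \<in> conj_class (W X) g"
  shows "h \<in> carrier (W X)" "cycle_type G h = cycle_type G g"
proof -
  interpret W: group "W X" by (rule group_wreath)
  obtain k where k: "k \<in> carrier (W X)" "h = k \<otimes>\<^bsub>W X\<^esub> g \<otimes>\<^bsub>W X\<^esub> inv\<^bsub>W X\<^esub> k"
    using assms(2) unfolding conj_class_def by blast
  then show h: "h \<in> carrier (W X)" using assms(1) by simp
  have "k \<otimes>\<^bsub>W X\<^esub> g = h \<otimes>\<^bsub>W X\<^esub> k"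
    using k assms(1) by (simp add: W.m_assoc)
  then have "conj_class (W X) g = conj_class (W X) h"
    using W.conj_class_eq_iff[OF assms(1) h] k(1) by blast
  then show "cycle_type G h = cycle_type G g"
    using conj_class_wreath_eq_iff[OF assms(1) h] by simp
qed

lemma inv_letters_on:
  assumes "s \<in> letters_on X"
  shows "inv\<^bsub>W X\<^esub> s \<in> letters_on X"
proof -
  interpret W: group "W X" by (rule group_wreath)
  from assms show ?thesis
  proof (cases rule: letters_onE)
    case (point u a)
    have "(\<lambda>x. (if x = u then inv a else \<one>) \<otimes> ((\<lambda>_. \<one>)(u := a)) x) = (\<lambda>_. \<one>)"
      using point(2) by (auto simp: fun_eq_iff)
    then have "point_elem G u (inv a) \<otimes>\<^bsub>W X\<^esub> point_elem G u a = \<one>\<^bsub>W X\<^esub>"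
      unfolding point_elem_def[of G u a] point_elem_mult one_wreath by simp
    then have "inv\<^bsub>W X\<^esub> s = point_elem G u (inv a)"
      unfolding point(3) using point by (intro W.inv_equality) (auto intro: point_elem_closed)
    then show ?thesis using point unfolding letters_on_def by auto
  next
    case (transp x y)
    have "transp_elem G x y \<otimes>\<^bsub>W X\<^esub> transp_elem G x y = \<one>\<^bsub>W X\<^esub>"
      unfolding transp_elem_def[of G x y] by (simp add: mult_wreath one_wreath)
    then have "inv\<^bsub>W X\<^esub> s = transp_elem G x y"
      unfolding transp(3) using transp by (intro W.inv_equality) (auto intro: transp_elem_closed)
    then show ?thesis using assms transp(3) by simp
  qed
qed

text \<open>Guarantees that the \<open>LEAST\<close> in \<open>word_length\<close> ranges over a
  nonempty set.\<close>

lemma generate_imp_word: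
  assumes "S \<subseteq> carrier G" "h \<in> generate G S"
  shows "\<exists>w. set w \<subseteq> S \<union> (\<lambda>s. inv s) ` S \<and> word_prod G w = h"
  using assms(2)
proof (induction rule: generate.induct)
  case one
  show ?case by (rule exI[of _ "[]"]) simp
next
  case (incl h)
  then show ?case using assms(1) by (intro exI[of _ "[h]"]) auto
next
  case (inv h)
  then show ?case using assms(1) by (intro exI[of _ "[inv h]"]) auto
next
  case (eng h1 h2)
  then obtain v w where vw: "set v \<subseteq> S \<union> (\<lambda>s. inv s) ` S" "word_prod G v = h1"
    "set w \<subseteq> S \<union> (\<lambda>s. inv s) ` S" "word_prod G w = h2" by blast
  moreover have "S \<union> (\<lambda>s. inv s) ` S \<subseteq> carrier G" using assms(1) by auto
  ultimately have "word_prod G (v @ w) = h1 \<otimes> h2"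
    using word_prod_append(2)[of v w] by (metis subset_trans)
  then show ?case using vw by (intro exI[of _ "v @ w"]) simp
qed

text \<open>Every conjugate of \<open>g\<close> has the same cycle type, so the lower bound holds
  throughout the class. The word realizing this cycle type represents a conjugate of
  \<open>g\<close> and attains the bound.\<close>

theorem conj_length_wreath:
  fixes P T :: "(('x \<Rightarrow> 'a) \<times> ('x \<Rightarrow> 'x)) set"
  assumes PC: "PCwr G X P T" and gen: "generate (W X) (P \<union> T) = carrier (W X)"
    and g: "g \<in> carrier (W X)" and B: "set_mset B \<subseteq> cycle_items" "cycle_type G g = expand B"
  shows "conj_length (W X) (P \<union> T) g = (\<Sum>v\<in>#B. item_weight v)"
proof -
  interpret W: group "W X" by (rule group_wreath)
  let ?S = "P \<union> T"
  let ?L = "?S \<union> (\<lambda>s. inv\<^bsub>W X\<^esub> s) ` ?S"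
  have "?S \<subseteq> letters_on X"
    using PC unfolding PCwr_def point_elems_def transp_elems_def letters_on_def by blast
  then have L: "?L \<subseteq> letters_on X" "?S \<subseteq> carrier (W X)"
    using inv_letters_on[of _ X] letters_on_carrier[of X] by blast+
  have lower: "(\<Sum>v\<in>#B. item_weight v) \<le> word_length (W X) ?S h" if h: "h \<in> conj_class (W X) g" for h
  proof -
    note hc = cycle_type_conj_class[OF g h]
    have "\<exists>n w. length w = n \<and> set w \<subseteq> ?L \<and> word_prod (W X) w = h"
      using W.generate_imp_word[OF L(2)] gen hc(1) by blast
    then have "\<exists>w. length w = word_length (W X) ?S h \<and> set w \<subseteq> ?L \<and> word_prod (W X) w = h"
      unfolding word_length_def by (rule LeastI_ex)
    then obtain w where w: "length w = word_length (W X) ?S h" "set w \<subseteq> ?L" "word_prod (W X) w = h"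
      by blast
    then show ?thesis
      using sum_item_weight_le_length[OF subset_trans[OF w(2) L(1)] B(1)] hc(2) B(2) by simp
  qed
  obtain w where w: "set w \<subseteq> ?S" "length w = (\<Sum>v\<in>#B. item_weight v)"
    "word_prod (W X) w \<in> carrier (W X)" "cycle_type G (word_prod (W X) w) = expand B"
    using PCwr_realizes_cycle_type[OF PC B(1)] by blast
  have "word_prod (W X) w \<in> conj_class (W X) g"
    using conj_class_wreath_eq_iff[OF g w(3)] B(2) w(4) W.conj_class_self[OF w(3)] by simp
  moreover have upper: "word_length (W X) ?S (word_prod (W X) w) \<le> (\<Sum>v\<in>#B. item_weight v)"
    unfolding word_length_def using w(1,2) by (intro Least_le exI[of _ w]) auto
  ultimately have "\<exists>h\<in>conj_class (W X) g. word_length (W X) ?S h = (\<Sum>v\<in>#B. item_weight v)"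
    using lower le_antisym by blast
  then show ?thesis
    unfolding conj_length_def by (rule Least_equality) (use lower in blast)
qed

lemma cycle_types_of_length:
  fixes P T :: "(('x \<Rightarrow> 'a) \<times> ('x \<Rightarrow> 'x)) set"
  assumes PC: "PCwr G X P T" and gen: "generate (W X) (P \<union> T) = carrier (W X)"
  shows "cycle_type G ` {g \<in> carrier (W X). conj_length (W X) (P \<union> T) g = n} =
    expand ` weighted_multisets cycle_items item_weight n"
proof (intro equalityI image_subsetI)
  fix g assume "g \<in> {g \<in> carrier (W X). conj_length (W X) (P \<union> T) g = n}"
  then have g: "g \<in> carrier (W X)" "conj_length (W X) (P \<union> T) g = n" by simp_all
  obtain B where B: "set_mset B \<subseteq> cycle_items" "cycle_type G g = expand B"
    using cycle_type_decomp[OF g(1)] by blast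
  then show "cycle_type G g \<in> expand ` weighted_multisets cycle_items item_weight n"
    using conj_length_wreath[OF PC gen g(1) B] g(2) by (auto simp: weighted_multisets_def)
next
  fix B assume "B \<in> weighted_multisets cycle_items item_weight n"
  then have B: "set_mset B \<subseteq> cycle_items" "(\<Sum>v\<in>#B. item_weight v) = n"
    by (simp_all add: weighted_multisets_def)
  obtain w where w: "word_prod (W X) w \<in> carrier (W X)" "cycle_type G (word_prod (W X) w) = expand B"
    using PCwr_realizes_cycle_type[OF PC B(1)] by blast
  have "conj_length (W X) (P \<union> T) (word_prod (W X) w) = n"
    using conj_length_wreath[OF PC gen w(1) B(1) w(2)] B(2) by simp
  then show "expand B \<in> cycle_type G ` {g \<in> carrier (W X). conj_length (W X) (P \<union> T) g = n}"
    using w by (metis (mono_tags, lifting) imageI mem_Collect_eq)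
qed

section \<open>Counting cycles by weight and truncating to finitely many\<close>

lemma cycle_items_iff:
  "(k, c) \<in> cycle_items \<longleftrightarrow> k \<ge> 1 \<and> c \<in> conj_classes G \<and> (c = {\<one>} \<longrightarrow> k \<noteq> 1)"
  unfolding cycle_items_def by blast

lemma item_weight_fibre:
  assumes "m \<ge> 1"
  shows "card {v \<in> cycle_items. item_weight v = m} = card (conj_classes G)"
proof -
  \<comment> \<open>For a given class \<open>c\<close> the weight equation has exactly one solution
    for the length: a trivial product saves one letter, so its cycle is one point longer.\<close>
  define f where "f = (\<lambda>c. (if c = {\<one>} then Suc m else m, c))"
  have iff: "(k, c) \<in> cycle_items \<and> item_weight (k, c) = m \<longleftrightarrow> c \<in> conj_classes G \<and> (k, c) = f c" for k c
    using assms by (cases "c = {\<one>}") (auto simp: f_def cycle_items_iff item_weight_def)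
  have snd: "snd (f c) = c" for c by (simp add: f_def)
  have "{v \<in> cycle_items. item_weight v = m} = f ` conj_classes G"
  proof (intro equalityI subsetI)
    fix v assume "v \<in> {v \<in> cycle_items. item_weight v = m}"
    then have "snd v \<in> conj_classes G \<and> v = f (snd v)" using iff[of "fst v" "snd v"] by simp
    then show "v \<in> f ` conj_classes G" by (intro image_eqI[of v f "snd v"]) blast+
  next
    fix v assume "v \<in> f ` conj_classes G"
    then obtain c where "c \<in> conj_classes G" "v = f c" by (rule imageE)
    then show "v \<in> {v \<in> cycle_items. item_weight v = m}"
    proof -
      have "(fst v, c) = f c" using \<open>v = f c\<close> snd[of c] by (metis prod.collapse)
      then have "f c \<in> cycle_items \<and> item_weight (f c) = m"
        using iff[of "fst v" c] \<open>c \<in> conj_classes G\<close> by simp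
      then show ?thesis using \<open>v = f c\<close> by simp
    qed
  qed
  moreover have "inj_on f (conj_classes G)" using snd by (rule inj_on_inverseI)
  ultimately show ?thesis by (simp add: card_image)
qed

lemma finite_light_items:
  assumes "finite (carrier G)"
  shows "finite {v \<in> cycle_items. item_weight v \<le> N}"
proof (rule finite_subset)
  show "{v \<in> cycle_items. item_weight v \<le> N} \<subseteq> {..Suc N} \<times> conj_classes G"
  proof
    fix v assume v: "v \<in> {v \<in> cycle_items. item_weight v \<le> N}"
    obtain k c where "v = (k, c)" by (cases v)
    then show "v \<in> {..Suc N} \<times> conj_classes G"
      using v by (cases "c = {\<one>}") (auto simp: cycle_items_iff item_weight_def)
  qed
  show "finite ({..Suc N} \<times> conj_classes G)"
    using assms by (simp add: conj_classes_def)
qed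

end

text \<open>No member can outweigh the total. This replaces the infinite set of cycle items by a
  finite one, to which the generating function formula applies.\<close>

lemma weighted_multisets_light:
  fixes w :: "'i \<Rightarrow> nat"
  assumes "n \<le> N"
  shows "weighted_multisets J w n = weighted_multisets {v \<in> J. w v \<le> N} w n"
proof -
  have le: "w v \<le> (\<Sum>v\<in>#A. w v)" if "v \<in># A" for v and A :: "'i multiset"
  proof -
    obtain B where "A = add_mset v B" using \<open>v \<in># A\<close> by (metis multi_member_split)
    then show ?thesis by simp
  qed
  have "set_mset A \<subseteq> J \<longleftrightarrow> set_mset A \<subseteq> {v \<in> J. w v \<le> N}" if "(\<Sum>v\<in>#A. w v) = n" for A
    using le[of _ A] that assms by fastforce
  then show ?thesis unfolding weighted_multisets_def by blast
qed

text \<open>Both images are the quotient of \<open>A\<close> by the same equivalence relation. This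
  passes from conjugacy classes to cycle types.\<close>

lemma card_image_same_kernel:
  assumes "\<And>x y. x \<in> A \<Longrightarrow> y \<in> A \<Longrightarrow> f x = f y \<longleftrightarrow> g x = g y"
  shows "finite (f ` A) \<longleftrightarrow> finite (g ` A)" "card (f ` A) = card (g ` A)"
proof -
  have inv: "inv_into A f (f x) \<in> A" "f (inv_into A f (f x)) = f x" if "x \<in> A" for x
    using that by (auto intro: inv_into_into f_inv_into_f)
  then have eq: "g (inv_into A f (f x)) = g x" if "x \<in> A" for x
    using that assms[of "inv_into A f (f x)" x] by simp
  have "bij_betw (\<lambda>y. g (inv_into A f y)) (f ` A) (g ` A)"
    unfolding bij_betw_def inj_on_def using eq assms by (auto simp: image_iff)
  then show "finite (f ` A) \<longleftrightarrow> finite (g ` A)" "card (f ` A) = card (g ` A)"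
    by (auto dest: bij_betw_finite bij_betw_same_card)
qed

context group
begin

lemma wreath_conj_growth:
  fixes P T :: "(('x \<Rightarrow> 'a) \<times> ('x \<Rightarrow> 'x)) set"
  assumes fin: "finite (carrier G)"
    and PC: "PCwr G X P T" and gen: "generate (W X) (P \<union> T) = carrier (W X)"
  shows "finite (classes_of_length (W X) (P \<union> T) n)"
    and "n \<le> Suc N \<Longrightarrow> of_nat (conj_growth (W X) (P \<union> T) n) =
      fps_nth (\<Prod>i\<le>N. inverse ((1 - fps_X ^ Suc i) ^ card (conj_classes G)) :: rat fps) n"
proof -
  let ?A = "{g \<in> carrier (W X). conj_length (W X) (P \<union> T) g = n}"
  let ?J = "\<lambda>N. {v \<in> cycle_items. item_weight v \<le> N}"
  have ker: "conj_class (W X) x = conj_class (W X) y \<longleftrightarrow> cycle_type G x = cycle_type G y"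
    if "x \<in> ?A" "y \<in> ?A" for x y
    using that conj_class_wreath_eq_iff by blast
  have finw: "finite (weighted_multisets (?J N) item_weight n)" for N
    by (intro finite_weighted_multisets finite_light_items fin) (auto dest: cycle_itemsD(2))
  have img: "cycle_type G ` ?A = expand ` weighted_multisets (?J N) item_weight n" if "n \<le> N" for N
    unfolding cycle_types_of_length[OF PC gen] weighted_multisets_light[OF that, symmetric] ..
  have "finite (cycle_type G ` ?A)"
    unfolding img[OF order_refl] by (intro finite_imageI finw)
  then show "finite (classes_of_length (W X) (P \<union> T) n)"
    using card_image_same_kernel(1)[where A = ?A and f = "conj_class (W X)" and g = "cycle_type G", OF ker]
    by (simp only: classes_of_length_def)
  assume n: "n \<le> Suc N"
  have inj: "inj_on expand (weighted_multisets (?J (Suc N)) item_weight n)"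
    by (rule inj_onI, rule expand_inject) (auto simp: weighted_multisets_def dest!: subsetD cycle_itemsD(1))
  have "conj_growth (W X) (P \<union> T) n = card (weighted_multisets (?J (Suc N)) item_weight n)"
    using card_image_same_kernel(2)[where A = ?A and f = "conj_class (W X)" and g = "cycle_type G", OF ker]
      card_image[OF inj]
    by (simp only: conj_growth_def classes_of_length_def img[OF n])
  then have "of_nat (conj_growth (W X) (P \<union> T) n) =
      fps_nth (\<Prod>v\<in>?J (Suc N). inverse (1 - fps_X ^ item_weight v) :: rat fps) n"
    by (subst weighted_multisets_gf[symmetric]) (auto intro: finite_light_items fin dest: cycle_itemsD(2))
  also have "(\<Prod>v\<in>?J (Suc N). inverse (1 - fps_X ^ item_weight v) :: rat fps) =
    (\<Prod>i\<le>N. \<Prod>v | v \<in> ?J (Suc N) \<and> item_weight v - 1 = i. inverse (1 - fps_X ^ item_weight v))"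
    by (intro prod.group[symmetric] finite_light_items fin) auto
  also have "\<dots> = (\<Prod>i\<le>N. inverse ((1 - fps_X ^ Suc i) ^ card (conj_classes G)))"
  proof (rule prod.cong[OF refl])
    fix i assume "i \<in> {..N}"
    then have "{v. v \<in> ?J (Suc N) \<and> item_weight v - 1 = i} = {v \<in> cycle_items. item_weight v = Suc i}"
      using cycle_itemsD(2) by force
    then have "(\<Prod>v | v \<in> ?J (Suc N) \<and> item_weight v - 1 = i. inverse (1 - fps_X ^ item_weight v) :: rat fps) =
      (\<Prod>v | v \<in> cycle_items \<and> item_weight v = Suc i. inverse (1 - fps_X ^ Suc i))"
      by (intro prod.cong) auto
    then show "(\<Prod>v | v \<in> ?J (Suc N) \<and> item_weight v - 1 = i. inverse (1 - fps_X ^ item_weight v) :: rat fps) =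
      inverse ((1 - fps_X ^ Suc i) ^ card (conj_classes G))"
      using item_weight_fibre[of "Suc i"] by (simp add: fps_inverse_power del: power_Suc)
  qed
  finally show "of_nat (conj_growth (W X) (P \<union> T) n) =
      fps_nth (\<Prod>i\<le>N. inverse ((1 - fps_X ^ Suc i) ^ card (conj_classes G)) :: rat fps) n" .
qed

end

lemma Fhat_cong:
  assumes "\<And>i. 1 \<le> i \<Longrightarrow> i < n \<Longrightarrow> x i = y i"
  shows "Fhat n x = Fhat n y"
  unfolding Fhat_def by (intro sum.cong refl arg_cong2[where f = "(*)"] prod.cong) (use assms in auto)

theorem theorem1:
  fixes H :: "('a, 'b) monoid_scheme" and X :: "'x set"
    and S\<^sub>H S\<^sub>X S :: "(('x \<Rightarrow> 'a) \<times> ('x \<Rightarrow> 'x)) set"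
  defines "W \<equiv> wreath H X"
    and "M \<equiv> card (conj_classes H)"
  assumes "group H" and "finite (carrier H)"
    and "infinite X"
    and "S = S\<^sub>H \<union> S\<^sub>X" and "PCwr H X S\<^sub>H S\<^sub>X"
    and "generate W S = carrier W"
  shows "(\<forall>n. finite (classes_of_length W S n)) \<and>
    (\<lambda>n. inverse ((1 - fps_X ^ Suc n) ^ M)) has_prod conj_growth_series W S \<and>
    (\<forall>n\<ge>2. of_nat (conj_growth W S n) =
       Fhat n (\<lambda>i. of_nat (conj_growth W S i)) + of_nat M / of_nat n * of_nat (divisor_sum n))"
proof (intro conjI allI impI)
  define p :: "nat \<Rightarrow> rat fps" where "p = (\<lambda>N. \<Prod>i\<le>N. inverse ((1 - fps_X ^ Suc i) ^ M))"
  note growth = group.wreath_conj_growth[OF assms(3,4,7), of n for n, folded W_def, folded assms(6), OF assms(8)]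
  show "finite (classes_of_length W S n)" for n by (rule growth(1))
  have \<gamma>: "of_nat (conj_growth W S n) = p N $ n" if "n \<le> Suc N" for n N
    using growth(2)[OF that] unfolding p_def M_def .
  have p0: "p N $ 0 = 1" for N
    unfolding p_def prod_nth_0 by (intro prod.neutral ballI deriv_geometric_power(2)) simp
  \<comment> \<open>Convergence of power series is coefficientwise eventual equality, and
    coefficient \<open>n\<close> of the partial products is constant from \<open>N = n\<close>
    on.\<close>
  have "p \<longlonglongrightarrow> conj_growth_series W S"
  proof (rule tendsto_fpsI)
    fix n
    show "eventually (\<lambda>N. p N $ n = conj_growth_series W S $ n) sequentially"
      using eventually_ge_at_top[of n]
    proof eventually_elim
      case (elim N)
      then show ?case using \<gamma>[of n N] by (simp add: conj_growth_series_def)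
    qed
  qed
  \<comment> \<open>\<open>raw_has_prod\<close> demands a nonzero limit; here the constant
    coefficient is 1.\<close>
  moreover have "conj_growth_series W S \<noteq> 0"
  proof
    assume "conj_growth_series W S = 0"
    then have "conj_growth_series W S $ 0 = 0" by simp
    then show False using \<gamma>[of 0 0] p0[of 0] by (simp add: conj_growth_series_def)
  qed
  ultimately show "(\<lambda>n. inverse ((1 - fps_X ^ Suc n) ^ M)) has_prod conj_growth_series W S"
    unfolding has_prod_def raw_has_prod_def p_def by simp
  show "of_nat (conj_growth W S n) =
       Fhat n (\<lambda>i. of_nat (conj_growth W S i)) + of_nat M / of_nat n * of_nat (divisor_sum n)"
    if n: "2 \<le> n" for n
  proof -
    \<comment> \<open>The recurrence for \<open>n\<close> only reads coefficients up to
      \<open>n\<close>, so it can be proved for the finite product \<open>p n\<close> in place of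
      the limit.\<close>
    have "Fhat n (\<lambda>i. of_nat (conj_growth W S i)) = Fhat n (\<lambda>i. p n $ i)"
      by (rule Fhat_cong) (simp add: \<gamma>[of _ n])
    moreover have "(fps_deriv (p n) * inverse (p n)) $ (n - 1) = of_nat M * of_nat (divisor_sum n)"
      unfolding p_def by (rule log_deriv_partition_prod(1)) (use n in simp)
    ultimately show ?thesis
      using fps_ln_recurrence[OF p0 n, of n] \<gamma>[of n n] by simp
  qed
qed

end
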